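(* There exist constants $c_1, c_2>0$ and a positive integer $m_0$ such that for every even integer $m\ge m_0$, $$c_1\, m^{1/3}\le \log v^{\ast}(2,m)\le c_2\, m^{1/3},$$ where $v^\ast(2,m)$ is the number of equivalence classes of two-dimensional centrally symmetric convex lattice polygons of area $m/2$.
   Context: A convex lattice polytope in $\mathbb{E}^d$ is the convex hull of a finite subset of the integer lattice $\mathbb{Z}^d$; it is called $d$-dimensional if it has non-empty interior (a polygon when $d=2$). Let $v(P)$ denote the volume (area if $d=2$) of $P$. Two $d$-dimensional convex lattice polytopes $P_1,P_2$ are equivalent if there is an affine transformation $\sigma$ of $\mathbb{E}^d$ with $\sigma(\mathbb{Z}^d)=\mathbb{Z}^d$ and $\sigma(P_1)=P_2$. Centrally symmetric means symmetric about a lattice point (equivalently, up to a lattice translation, $P=-P$). $v^\ast(d,m)$ denotes the number of equivalence classes of $d$-dimensional centrally symmetric convex lattice polytopes $P$ with $v(P)=m/d!$. *)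

theory Defs
  imports "HOL-Analysis.Analysis"
begin

definition int_lattice :: "(real ^ 'n) set" where
  "int_lattice = {x. \<forall>i. x $ i \<in> \<int>}"

definition lattice_polytope :: "(real ^ 'n) set \<Rightarrow> bool" where
  "lattice_polytope P \<longleftrightarrow> (\<exists>S. finite S \<and> S \<subseteq> int_lattice \<and> P = convex hull S)"

definition full_dim_lattice_polytope :: "(real ^ 'n) set \<Rightarrow> bool" where
  "full_dim_lattice_polytope P \<longleftrightarrow> lattice_polytope P \<and> interior P \<noteq> {}"

text \<open>The centre of symmetry is required to be a lattice point, not merely a half-integral one.\<close>

definition centrally_symmetric :: "(real ^ 'n) set \<Rightarrow> bool" where
  "centrally_symmetric P \<longleftrightarrow> (\<exists>c \<in> int_lattice. (\<lambda>x. 2 *\<^sub>R c - x) ` P = P)"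

definition affine_transformation :: "(real ^ 'n \<Rightarrow> real ^ 'n) \<Rightarrow> bool" where
  "affine_transformation \<sigma> \<longleftrightarrow> (\<exists>f b. linear f \<and> bij f \<and> \<sigma> = (\<lambda>x. f x + b))"

definition lattice_equivalent :: "(real ^ 'n) set \<Rightarrow> (real ^ 'n) set \<Rightarrow> bool" where
  "lattice_equivalent P Q \<longleftrightarrow>
     (\<exists>\<sigma>. affine_transformation \<sigma> \<and> \<sigma> ` int_lattice = int_lattice \<and> \<sigma> ` P = Q)"

definition cs_polytopes :: "nat \<Rightarrow> (real ^ 'n) set set" where
  "cs_polytopes m = {P. full_dim_lattice_polytope P \<and> centrally_symmetric P \<and>
     measure lebesgue P = real m / fact CARD('n)}"

definition cs_equiv_rel :: "nat \<Rightarrow> ((real ^ 'n) set \<times> (real ^ 'n) set) set" where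
  "cs_equiv_rel m = {(P, Q). P \<in> cs_polytopes m \<and> Q \<in> cs_polytopes m \<and> lattice_equivalent P Q}"

text \<open>The dimension \<open>d\<close> of \<open>v\<^sup>*(d, m)\<close> is passed as an index type with \<open>d\<close> elements.\<close>

definition v_star :: "'n::finite itself \<Rightarrow> nat \<Rightarrow> nat" where
  "v_star _ m = card ((cs_polytopes m :: (real ^ 'n) set set) // cs_equiv_rel m)"

lemma affine_transformation_id: "affine_transformation (\<lambda>x. x)"
  unfolding affine_transformation_def
  by (rule exI[of _ "\<lambda>x. x"], rule exI[of _ 0]) (auto simp: linear_ident bij_def)

lemma affine_transformation_comp:
  assumes "affine_transformation \<sigma>" "affine_transformation \<tau>"
  shows "affine_transformation (\<tau> \<circ> \<sigma>)"
proof -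
  obtain f b g c where f: "linear f" "bij f" "\<sigma> = (\<lambda>x. f x + b)"
    and g: "linear g" "bij g" "\<tau> = (\<lambda>x. g x + c)"
    using assms unfolding affine_transformation_def by blast
  have "\<tau> \<circ> \<sigma> = (\<lambda>x. (g \<circ> f) x + (g b + c))"
    by (auto simp: f g linear_add add.assoc)
  moreover have "linear (g \<circ> f)" "bij (g \<circ> f)"
    using f g by (auto intro: linear_compose bij_comp)
  ultimately show ?thesis unfolding affine_transformation_def by blast
qed

lemma affine_transformation_bij: "affine_transformation \<sigma> \<Longrightarrow> bij \<sigma>"
proof -
  assume "affine_transformation \<sigma>"
  then obtain f b where f: "bij f" "\<sigma> = (\<lambda>x. f x + b)"
    unfolding affine_transformation_def by blast
  have "\<sigma> = (\<lambda>x. x + b) \<circ> f" by (auto simp: f)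
  moreover have "bij (\<lambda>x. x + b)" by (rule bij_plus_right)
  ultimately show "bij \<sigma>" using f(1) bij_comp by blast
qed

lemma affine_transformation_inv:
  assumes "affine_transformation \<sigma>"
  shows "affine_transformation (inv \<sigma>)"
proof -
  obtain f b where f: "linear f" "bij f" "\<sigma> = (\<lambda>x. f x + b)"
    using assms unfolding affine_transformation_def by blast
  have lin: "linear (inv f)" using f(1,2) by (simp add: bij_is_inj inj_linear_imp_inv_linear)
  have "inv \<sigma> y = inv f y + inv f (- b)" for y
  proof (rule inv_f_eq)
    show "inj \<sigma>" using affine_transformation_bij[OF assms] by (rule bij_is_inj)
    show "\<sigma> (inv f y + inv f (- b)) = y"
      using f by (simp add: linear_add bij_is_surj surj_f_inv_f)
  qed
  then have "inv \<sigma> = (\<lambda>y. inv f y + inv f (- b))" by blast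
  moreover have "bij (inv f)" using f(2) by (rule bij_imp_bij_inv)
  ultimately show ?thesis using lin unfolding affine_transformation_def by blast
qed

lemma equiv_cs_equiv_rel: "equiv (cs_polytopes m :: (real ^ 'n) set set) (cs_equiv_rel m)"
proof (rule equivI)
  show "cs_equiv_rel m \<subseteq> cs_polytopes m \<times> cs_polytopes m"
    by (auto simp: cs_equiv_rel_def)
  show "refl_on (cs_polytopes m) (cs_equiv_rel m)"
    unfolding refl_on_def cs_equiv_rel_def lattice_equivalent_def
    using affine_transformation_id by fastforce
  show "sym (cs_equiv_rel m :: ((real ^ 'n) set \<times> (real ^ 'n) set) set)"
  proof (rule symI)
    fix P Q :: "(real ^ 'n) set" assume "(P, Q) \<in> cs_equiv_rel m"
    then obtain \<sigma> where \<sigma>: "affine_transformation \<sigma>" "\<sigma> ` int_lattice = int_lattice" "\<sigma> ` P = Q"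
      and PQ: "P \<in> cs_polytopes m" "Q \<in> cs_polytopes m"
      unfolding cs_equiv_rel_def lattice_equivalent_def by blast
    have inj: "inj \<sigma>" using affine_transformation_bij[OF \<sigma>(1)] by (rule bij_is_inj)
    have "inv \<sigma> ` int_lattice = int_lattice"
      using inj \<sigma>(2) by (metis image_inv_f_f)
    moreover have "inv \<sigma> ` Q = P"
      using inj \<sigma>(3) by (metis image_inv_f_f)
    ultimately show "(Q, P) \<in> cs_equiv_rel m"
      using affine_transformation_inv[OF \<sigma>(1)] PQ
      unfolding cs_equiv_rel_def lattice_equivalent_def by blast
  qed
  show "trans (cs_equiv_rel m :: ((real ^ 'n) set \<times> (real ^ 'n) set) set)"
  proof (rule transI)
    fix P Q R :: "(real ^ 'n) set"
    assume "(P, Q) \<in> cs_equiv_rel m" "(Q, R) \<in> cs_equiv_rel m"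
    then obtain \<sigma> \<tau> where \<sigma>: "affine_transformation \<sigma>" "\<sigma> ` int_lattice = int_lattice" "\<sigma> ` P = Q"
      and \<tau>: "affine_transformation \<tau>" "\<tau> ` int_lattice = int_lattice" "\<tau> ` Q = R"
      and PR: "P \<in> cs_polytopes m" "R \<in> cs_polytopes m"
      unfolding cs_equiv_rel_def lattice_equivalent_def by blast
    have "(\<tau> \<circ> \<sigma>) ` int_lattice = int_lattice" "(\<tau> \<circ> \<sigma>) ` P = R"
      using \<sigma> \<tau> by (simp_all only: image_comp[symmetric])
    then show "(P, R) \<in> cs_equiv_rel m"
      using affine_transformation_comp[OF \<sigma>(1) \<tau>(1)] PR
      unfolding cs_equiv_rel_def lattice_equivalent_def by blast
  qed
qed

end

(*
Upper bound. After a unimodular map a polygon of area m/2 containing the origin lies in a box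
|x| <= a, |y| <= b with ab <= 2m: minimise max |x|, shear so that a point attaining it has small
second coordinate, and compare with a triangle. Its vertices split into four chains on which
x increases and y decreases. A chain is determined by its first point and the set of its edge
vectors, because convexity orders them by slope, and the edge vectors form a set of pairs of
positive integers with coordinate sums at most 2a and 2b. A generating function bounds the number
of such sets by exp(3 (4ab)^(1/3)).

Lower bound. Take about m^(1/3) consecutive blocks of length 3 on a parabola y = x^2 - H with H of
order m^(2/3), and in each block keep one of the two inner lattice points as a vertex. Both
choices cut off the same area, so with the mirror image in the origin one obtains 2^n polygons of
equal area, which raising a single vertex makes equal to m/2. Only polynomially many of them are
equivalent to a given one, since an equivalence is determined by the images of three vertices.
*)

theory Submission
  imports Defs "HOL-Real_Asymp.Real_Asymp"
begin


subsection \<open>Counting chains\<close>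

text \<open>A lattice polygon symmetric about a lattice point has integral area, since opposite
  edges contribute equally to the shoelace sum; this is why \<open>m\<close> is even. In the upper
  bound the shape of the box is irrelevant: chains are bounded in terms of the product ab alone, and
  the polynomially many boxes contribute only O(log m) to the logarithm. The obstacle in the lower
  bound is that the area has to be exactly m/2, so the free choices must not change it. Three is the
  least block length with two inner lattice points, and these are mirror images within the block, so
  they cut off equal triangles. The parameter H then moves the area in steps of 12n. A vertex raised
  along a vertical edge, with its other neighbour at horizontal distance 1, fills the gaps between
  the steps. Since \<open>card\<close> of an infinite set is 0, the lower bound also needs the
  finiteness of the set of classes, which the injection behind the upper bound supplies.\<close>

lemma strict_sorted_key_unique:
  fixes k :: "'a \<Rightarrow> 'b::linorder"
  assumes "sorted_wrt (<) (map k xs)" "sorted_wrt (<) (map k ys)" "set xs = set ys"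
  shows "xs = ys"
proof -
  have "map k xs = map k ys"
    using assms by (intro strict_sorted_equal) auto
  moreover have "inj_on k (set xs \<union> set ys)"
    using assms by (metis Un_absorb distinct_map strict_sorted_iff)
  ultimately show ?thesis by (metis map_inj_on)
qed

text \<open>Second coordinates are recorded as drops, so that along a descending chain every edge
  vector is a pair of positive integers.\<close>

fun steps :: "(int \<times> int) list \<Rightarrow> (int \<times> int) list" where
  "steps (p # q # ps) = (fst q - fst p, snd p - snd q) # steps (q # ps)"
| "steps _ = []"

lemma length_steps: "length (steps ps) = length ps - 1"
  by (induction ps rule: steps.induct) auto

lemma steps_inj:
  assumes "length ps = length qs" "ps \<noteq> []" "hd ps = hd qs" "steps ps = steps qs"
  shows "ps = qs"
  using assms
proof (induction ps arbitrary: qs rule: steps.induct)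
  case (1 p q ps)
  then obtain p' q' ps' where [simp]: "qs = p' # q' # ps'"
    by (cases qs; cases "tl qs") auto
  have "q = q'" using "1.prems"(3,4) by (simp add: prod_eq_iff)
  moreover have "q # ps = q' # ps'"
    by (rule "1.IH") (use "1.prems" \<open>q = q'\<close> in auto)
  ultimately show ?case using "1.prems" by auto
next
  case ("2_2" v)
  then show ?case by (cases qs) auto
qed auto

text \<open>The upper right part of a polygon's boundary: each point is the unique maximum of a
  functional with positive coefficients. Reflections in the axes bring the other three parts into
  this position.\<close>

definition ne_chain :: "(int \<times> int) set \<Rightarrow> bool" where
  "ne_chain C \<longleftrightarrow> (\<forall>p\<in>C. \<exists>(\<alpha>::real) (\<beta>::real). 0 < \<alpha> \<and> 0 < \<beta> \<and>
     (\<forall>q\<in>C - {p}. \<alpha> * fst q + \<beta> * snd q < \<alpha> * fst p + \<beta> * snd p))"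

lemma ne_chainE:
  assumes "ne_chain C" "p \<in> C"
  obtains \<alpha> \<beta> :: real where "0 < \<alpha>" "0 < \<beta>"
    "\<And>q. q \<in> C \<Longrightarrow> q \<noteq> p \<Longrightarrow> \<alpha> * fst q + \<beta> * snd q < \<alpha> * fst p + \<beta> * snd p"
proof -
  have "\<exists>(\<alpha>::real) (\<beta>::real). 0 < \<alpha> \<and> 0 < \<beta> \<and>
     (\<forall>q\<in>C - {p}. \<alpha> * fst q + \<beta> * snd q < \<alpha> * fst p + \<beta> * snd p)"
    using assms(1)[unfolded ne_chain_def] assms(2) by (rule bspec)
  then show ?thesis using that by (elim exE conjE) auto
qed

definition slope :: "int \<times> int \<Rightarrow> real" where
  "slope d = snd d / fst d"

lemma ne_chain_fst_inj:
  assumes "ne_chain C" shows "inj_on fst C"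
proof (rule inj_onI, rule ccontr)
  fix p q assume pq: "p \<in> C" "q \<in> C" "fst p = fst q" "p \<noteq> q"
  have *: "snd q < snd p" if "p \<in> C" "q \<in> C" "fst p = fst q" "p \<noteq> q" for p q
  proof -
    obtain a b :: real where "0 < a" "0 < b" "a * fst q + b * snd q < a * fst p + b * snd p"
      using ne_chainE[OF assms \<open>p \<in> C\<close>] \<open>q \<in> C\<close> \<open>p \<noteq> q\<close> by metis
    then show ?thesis using \<open>fst p = fst q\<close> by simp
  qed
  show False using *[of p q] *[of q p] pq by simp
qed

lemma ne_chain_snd_less:
  assumes "ne_chain C" "p \<in> C" "q \<in> C" "fst p < fst q"
  shows "snd q < snd p"
proof -
  have "q \<noteq> p" using assms by auto
  then obtain a b :: real where ab: "0 < a" "0 < b" "a * fst q + b * snd q < a * fst p + b * snd p"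
    using ne_chainE[OF assms(1,2)] assms(3) by metis
  have "a * fst p < a * fst q" using ab assms by simp
  then have "b * snd q < b * snd p" using ab by linarith
  then show ?thesis using ab by simp
qed

text \<open>The functional exposing the middle point has a coefficient ratio \<open>a / b\<close>
  that separates the two slopes.\<close>

lemma ne_chain_slope_less:
  assumes "ne_chain C" "p \<in> C" "q \<in> C" "r \<in> C" "fst p < fst q" "fst q < fst r"
  shows "slope (fst q - fst p, snd p - snd q) < slope (fst r - fst q, snd q - snd r)"
proof -
  have ne: "p \<noteq> q" "r \<noteq> q" using assms by auto
  obtain a b :: real where ab: "0 < a" "0 < b" 
    "a * fst p + b * snd p < a * fst q + b * snd q" "a * fst r + b * snd r < a * fst q + b * snd q"
    using ne_chainE[OF assms(1,3)] assms(2,4) ne by metis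
  have "slope (fst q - fst p, snd p - snd q) < a / b"
    using ab assms(5) by (simp add: slope_def field_simps)
  also have "a / b < slope (fst r - fst q, snd q - snd r)"
    using ab assms(6) by (simp add: slope_def field_simps)
  finally show ?thesis .
qed

lemma steps_props:
  assumes "ne_chain C" "set ps \<subseteq> C" "sorted_wrt (\<lambda>p q. fst p < fst q) ps" "ps \<noteq> []"
  shows "sorted_wrt (<) (map slope (steps ps))"
    and "\<forall>d\<in>set (steps ps). 0 < fst d \<and> 0 < snd d"
    and "sum_list (map fst (steps ps)) = fst (last ps) - fst (hd ps)"
    and "sum_list (map snd (steps ps)) = snd (hd ps) - snd (last ps)"
proof -
  have "sorted_wrt (<) (map slope (steps ps)) \<and> (\<forall>d\<in>set (steps ps). 0 < fst d \<and> 0 < snd d)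
    \<and> sum_list (map fst (steps ps)) = fst (last ps) - fst (hd ps)
    \<and> sum_list (map snd (steps ps)) = snd (hd ps) - snd (last ps)"
    using assms(2-)
  proof (induction ps rule: steps.induct)
    case (1 p q ps)
    then have IH: "sorted_wrt (<) (map slope (steps (q # ps))) \<and> (\<forall>d\<in>set (steps (q # ps)). 0 < fst d \<and> 0 < snd d)
    \<and> sum_list (map fst (steps (q # ps))) = fst (last (q # ps)) - fst (hd (q # ps))
    \<and> sum_list (map snd (steps (q # ps))) = snd (hd (q # ps)) - snd (last (q # ps))" by auto
    have pq: "p \<in> C" "q \<in> C" "fst p < fst q" using 1 by auto
    have "sorted_wrt (<) (map slope (steps (p # q # ps)))"
    proof (cases ps)
      case (Cons r rs)
      then have "r \<in> C" "fst q < fst r" using 1 by auto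
      then show ?thesis using ne_chain_slope_less[OF assms(1) pq(1,2) _ pq(3)] IH Cons
        by (auto simp: sorted_wrt2 simp del: sorted_wrt.simps)
    qed simp
    then show ?case using IH ne_chain_snd_less[OF assms(1) pq] pq by simp
  qed auto
  then show "sorted_wrt (<) (map slope (steps ps))"
    and "\<forall>d\<in>set (steps ps). 0 < fst d \<and> 0 < snd d"
    and "sum_list (map fst (steps ps)) = fst (last ps) - fst (hd ps)"
    and "sum_list (map snd (steps ps)) = snd (hd ps) - snd (last ps)" by blast+
qed

definition ne_chains :: "int \<Rightarrow> int \<Rightarrow> (int \<times> int) set set" where
  "ne_chains a b = {C. C \<subseteq> {-a..a} \<times> {-b..b} \<and> ne_chain C}"

definition step_sets :: "int \<Rightarrow> int \<Rightarrow> (int \<times> int) set set" where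
  "step_sets X Y = {D. D \<subseteq> {1..X} \<times> {1..Y} \<and> sum fst D \<le> X \<and> sum snd D \<le> Y}"

lemma finite_step_sets: "finite (step_sets X Y)"
  unfolding step_sets_def by (rule finite_subset[of _ "Pow ({1..X} \<times> {1..Y})"]) auto

lemma finite_ne_chains: "finite (ne_chains a b)"
  unfolding ne_chains_def by (rule finite_subset[of _ "Pow ({-a..a} \<times> {-b..b})"]) auto

text \<open>The first point and the set of steps form an injective code: slopes increase strictly
  along a chain, so the set already fixes the order of the steps. The coordinate sums telescope and
  are at most the side lengths of the box. The summand 1 accounts for the empty chain, which has no
  first point.\<close>

lemma card_ne_chains_le:
  assumes "0 \<le> a" "0 \<le> b"
  shows "card (ne_chains a b) \<le> 1 + nat (2*a+1) * nat (2*b+1) * card (step_sets (2*a) (2*b))"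
proof -
  define xs where "xs C = map (inv_into C fst) (sorted_list_of_set (fst ` C))" for C :: "(int \<times> int) set"
  define F where "F C = (hd (xs C), set (steps (xs C)))" for C
  have xs: "set (xs C) = C" "sorted_wrt (\<lambda>p q. fst p < fst q) (xs C)" if "C \<in> ne_chains a b" for C
  proof -
    have fin: "finite C" using that unfolding ne_chains_def by (auto intro: finite_subset)
    have inj: "inj_on fst C" using that ne_chain_fst_inj unfolding ne_chains_def by blast
    show "set (xs C) = C"
      unfolding xs_def using fin inj by (simp add: image_image)
    have "sorted_wrt (\<lambda>x y. fst (inv_into C fst x) < fst (inv_into C fst y)) (sorted_list_of_set (fst ` C))"
      by (rule sorted_wrt_mono_rel[of _ "(<)"]) (use fin in \<open>auto simp: f_inv_into_f\<close>)
    then show "sorted_wrt (\<lambda>p q. fst p < fst q) (xs C)" 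
      unfolding xs_def by (simp add: sorted_wrt_map)
  qed
  have st: "sorted_wrt (<) (map slope (steps (xs C)))"
      "F C \<in> ({-a..a} \<times> {-b..b}) \<times> step_sets (2*a) (2*b)" if C: "C \<in> ne_chains a b - {{}}" for C
  proof -
    have C': "ne_chain C" "C \<subseteq> {-a..a} \<times> {-b..b}" using C by (auto simp: ne_chains_def)
    have ne: "xs C \<noteq> []" using C xs[of C] by auto
    have s: "set (xs C) \<subseteq> C" using C xs[of C] by auto
    note P = steps_props[OF C'(1) s _ ne]
    have so: "sorted_wrt (\<lambda>p q. fst p < fst q) (xs C)" using C xs(2) by blast
    note P = P[OF so]
    show "sorted_wrt (<) (map slope (steps (xs C)))" by (rule P)
    have dist: "distinct (steps (xs C))"
      using P(1) strict_sorted_iff distinct_map by blast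
    have h: "hd (xs C) \<in> C" "last (xs C) \<in> C" using ne s by auto
    have hb: "hd (xs C) \<in> {-a..a} \<times> {-b..b}" "last (xs C) \<in> {-a..a} \<times> {-b..b}" using h C' by auto
    have sm: "sum fst (set (steps (xs C))) \<le> 2*a" "sum snd (set (steps (xs C))) \<le> 2*b"
      using P(3,4) hb dist by (auto simp: sum_list_distinct_conv_sum_set mem_Times_iff)
    have "d \<in> {1..2*a} \<times> {1..2*b}" if d: "d \<in> set (steps (xs C))" for d
    proof -
      have "fst d \<le> sum fst (set (steps (xs C)))" "snd d \<le> sum snd (set (steps (xs C)))"
        using P(2) d by (auto intro!: member_le_sum intro: less_imp_le)
      then show ?thesis using sm P(2) d by (auto simp: mem_Times_iff)
    qed
    then show "F C \<in> ({-a..a} \<times> {-b..b}) \<times> step_sets (2*a) (2*b)"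
      using hb sm unfolding F_def step_sets_def by auto
  qed
  have "inj_on F (ne_chains a b - {{}})"
  proof (rule inj_onI)
    fix C D assume CD: "C \<in> ne_chains a b - {{}}" "D \<in> ne_chains a b - {{}}" "F C = F D"
    have e: "steps (xs C) = steps (xs D)"
      by (rule strict_sorted_key_unique[of slope]) (use CD st in \<open>auto simp: F_def\<close>)
    have ne: "xs C \<noteq> []" "xs D \<noteq> []" using CD xs by force+
    have "length (xs C) = length (xs D)"
      using arg_cong[OF e, of length] ne by (cases "xs C"; cases "xs D") (auto simp: length_steps)
    then have "xs C = xs D" using steps_inj e ne CD by (auto simp: F_def)
    then show "C = D" using xs CD by (metis DiffD1)
  qed
  then have "card (ne_chains a b - {{}}) \<le> card (({-a..a} \<times> {-b..b}) \<times> step_sets (2*a) (2*b))"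
    using st(2) finite_step_sets by (intro card_inj_on_le[of F] image_subsetI finite_cartesian_product) auto
  also have "\<dots> = nat (2*a+1) * nat (2*b+1) * card (step_sets (2*a) (2*b))"
    by (simp add: card_cartesian_product algebra_simps)
  finally show ?thesis by (simp add: card_Diff_singleton_if split: if_splits)
qed

section \<open>Generating function for sets of edge vectors\<close>

lemma sum_exp_le:
  fixes \<alpha> :: real assumes "0 < \<alpha>"
  shows "(\<Sum>i\<in>{1..X::int}. exp (- (\<alpha> * i))) \<le> 1 / \<alpha>"
proof -
  \<comment> \<open>Strengthened for the induction: the right-hand side is \<alpha> times the
    integral of exp (-\<alpha> x) over [0, n], with which the sum is compared term by term.\<close>
  have *: "(\<Sum>i\<in>{1..int n}. exp (- (\<alpha> * i))) * \<alpha> \<le> 1 - exp (- (\<alpha> * n))" for n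
  proof (induction n)
    case (Suc n)
    have "{1..int (Suc n)} = insert (int (Suc n)) {1..int n}" by auto
    then have "(\<Sum>i\<in>{1..int (Suc n)}. exp (- (\<alpha> * i))) * \<alpha>
       = \<alpha> * exp (- (\<alpha> * Suc n)) + (\<Sum>i\<in>{1..int n}. exp (- (\<alpha> * i))) * \<alpha>"
      by (simp add: algebra_simps)
    also have "\<dots> \<le> \<alpha> * exp (- (\<alpha> * Suc n)) + 1 - exp (- (\<alpha> * n))" using Suc by simp
    also have "exp (- (\<alpha> * n)) = exp \<alpha> * exp (- (\<alpha> * Suc n))"
      by (simp add: exp_add[symmetric] algebra_simps)
    also have "\<alpha> * exp (- (\<alpha> * Suc n)) + 1 - exp \<alpha> * exp (- (\<alpha> * Suc n)) \<le> 1 - exp (- (\<alpha> * Suc n))"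
      using mult_right_mono[OF exp_ge_add_one_self[of \<alpha>], of "exp (- (\<alpha> * Suc n))"]
      by (simp add: algebra_simps)
    finally show ?case .
  qed simp
  show ?thesis
  proof (cases "X \<ge> 0")
    case True
    have "(\<Sum>i\<in>{1..X}. exp (- (\<alpha> * i))) * \<alpha> \<le> 1 - exp (- (\<alpha> * nat X))"
      using *[of "nat X"] True by simp
    also have "\<dots> \<le> 1" by simp
    finally show ?thesis using assms by (simp add: field_simps)
  qed (use assms in simp)
qed

text \<open>Each set \<open>D\<close> is weighted by \<open>exp (- \<alpha> * sum fst D - \<beta> * sum snd D)\<close>, so that the sum over all sets
  factors into a product; \<open>\<alpha>\<close> and \<open>\<beta>\<close> are chosen so that the three terms of the exponent coincide.\<close>

lemma card_step_sets_le:
  assumes "0 < X" "0 < Y"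
  shows "card (step_sets X Y) \<le> exp (3 * (real_of_int (X * Y)) powr (1/3))"
proof -
  define c where "c = (real_of_int (X * Y)) powr (1/3)"
  have XY: "0 < real_of_int (X * Y)" using assms by (simp del: of_int_mult)
  have c: "c > 0" "c * c * c = X * Y"
    using XY unfolding c_def by (simp_all only: powr_add[symmetric] powr_gt_zero) simp_all
  define \<alpha> \<beta> where "\<alpha> = c / X" and "\<beta> = c / Y"
  have ab: "0 < \<alpha>" "0 < \<beta>" "\<alpha> * X = c" "\<beta> * Y = c" using assms c by (auto simp: \<alpha>_def \<beta>_def)
  have ne: "X \<noteq> 0" "Y \<noteq> 0" using assms by auto
  have ab2: "1 / \<alpha> * (1 / \<beta>) = c"
  proof -
    have "1 / \<alpha> * (1 / \<beta>) = X * Y / (c * c)" by (simp add: \<alpha>_def \<beta>_def)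
    also have "\<dots> = c" unfolding of_int_mult[symmetric] c(2)[symmetric] using c(1) by simp
    finally show ?thesis .
  qed
  define U where "U = {1..X} \<times> {1..Y}"
  define w where "w d = exp (- (\<alpha> * fst d) - \<beta> * snd d)" for d :: "int \<times> int"
  have finU: "finite U" by (simp add: U_def)
  have "real (card (step_sets X Y)) = (\<Sum>D\<in>step_sets X Y. 1)" by simp
  also have "\<dots> \<le> (\<Sum>D\<in>step_sets X Y. exp (2 * c) * prod w D)"
  proof (rule sum_mono)
    fix D assume D: "D \<in> step_sets X Y"
    then have fin: "finite D" using finU by (auto simp: step_sets_def U_def intro: finite_subset)
    have "prod w D = exp (\<Sum>d\<in>D. (- (\<alpha> * fst d) - \<beta> * snd d))"
      using fin by (simp add: w_def exp_sum)
    also have "(\<Sum>d\<in>D. (- (\<alpha> * fst d) - \<beta> * snd d)) = - \<alpha> * (sum fst D) - \<beta> * (sum snd D)"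
      by (simp add: sum_subtractf sum_negf sum_distrib_left)
    finally have pw: "prod w D = exp (- \<alpha> * (sum fst D) - \<beta> * (sum snd D))" .
    have "\<alpha> * (sum fst D) \<le> \<alpha> * X" "\<beta> * (sum snd D) \<le> \<beta> * Y"
      using D ab(1,2) by (auto simp: step_sets_def simp del: of_int_sum)
    then have "0 \<le> 2 * c + (- \<alpha> * (sum fst D) - \<beta> * (sum snd D))" using ab by simp
    then show "1 \<le> exp (2 * c) * prod w D" unfolding pw by (simp flip: exp_add del: of_int_sum)
  qed
  also have "\<dots> \<le> (\<Sum>D\<in>Pow U. exp (2 * c) * prod w D)"
    by (rule sum_mono2) (use finU in \<open>auto simp: step_sets_def U_def w_def intro!: prod_nonneg mult_nonneg_nonneg\<close>)
  also have "\<dots> = exp (2 * c) * (\<Prod>d\<in>U. (w d + 1))"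
    using finU by (simp add: prod_add sum_distrib_left)
  also have "(\<Prod>d\<in>U. (w d + 1)) \<le> (\<Prod>d\<in>U. exp (w d))"
    by (rule prod_mono) (auto simp: w_def add_nonneg_nonneg add.commute)
  also have "\<dots> = exp (sum w U)" using finU by (simp add: exp_sum)
  also have "sum w U = (\<Sum>i\<in>{1..X}. exp (- (\<alpha> * i))) * (\<Sum>j\<in>{1..Y}. exp (- (\<beta> * j)))"
    unfolding U_def w_def sum_product sum.cartesian_product by (simp add: exp_diff exp_minus field_simps split_def)
  also have "\<dots> \<le> 1 / \<alpha> * (1 / \<beta>)"
    by (rule mult_mono) (use ab sum_exp_le in \<open>auto intro!: sum_nonneg\<close>)
  also have "exp (2 * c) * exp (1 / \<alpha> * (1 / \<beta>)) = exp (3 * c)" 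
    unfolding ab2 by (simp flip: exp_add)
  finally show ?thesis unfolding c_def by simp
qed


subsection \<open>The area of a convex polygon\<close>

definition cross2 :: "real ^ 2 \<Rightarrow> real ^ 2 \<Rightarrow> real" where
  "cross2 a b = a $ 1 * b $ 2 - a $ 2 * b $ 1"

text \<open>Twice the signed area of the triangle, positive for counterclockwise triples.\<close>

definition orient :: "real ^ 2 \<Rightarrow> real ^ 2 \<Rightarrow> real ^ 2 \<Rightarrow> real" where
  "orient a b c = cross2 (b - a) (c - a)"

lemma orient_rotate: "orient a b c = orient b c a"
  by (simp add: orient_def cross2_def algebra_simps)

lemma orient_swap: "orient b a c = - orient a b c"
  by (simp add: orient_def cross2_def algebra_simps)

lemma orient_degenerate [simp]: "orient a a c = 0" "orient a b a = 0" "orient a b b = 0"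
  by (simp_all add: orient_def cross2_def)

lemma orient_uminus [simp]: "orient (- a) (- b) (- c) = orient a b c"
  by (simp add: orient_def cross2_def algebra_simps)

lemma orient_eq_inner:
  "orient a b z = vector [a $ 2 - b $ 2, b $ 1 - a $ 1] \<bullet> z - vector [a $ 2 - b $ 2, b $ 1 - a $ 1] \<bullet> a"
  by (simp add: orient_def cross2_def inner_vec_def sum_2 algebra_simps)

lemma orient_eq_cross2: "orient a b c = cross2 a b + cross2 b c + cross2 c a"
  by (simp add: orient_def cross2_def algebra_simps)

lemma convex_orient_ge: "convex {z. 0 \<le> orient a b z}"
proof -
  have "{z. 0 \<le> orient a b z} = {z. vector [a $ 2 - b $ 2, b $ 1 - a $ 1] \<bullet> z
      \<ge> vector [a $ 2 - b $ 2, b $ 1 - a $ 1] \<bullet> a}"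
    by (auto simp: orient_eq_inner)
  then show ?thesis by (simp only: convex_halfspace_ge)
qed

lemma orient_ge_hull:
  assumes "\<And>z. z \<in> S \<Longrightarrow> 0 \<le> orient a b z" "z \<in> convex hull S"
  shows "0 \<le> orient a b z"
proof -
  have "convex hull S \<subseteq> {z. 0 \<le> orient a b z}"
    by (rule hull_minimal) (use assms(1) convex_orient_ge in auto)
  then show ?thesis using assms(2) by blast
qed

text \<open>Cramer's rule: ratios of signed areas are the barycentric coordinates. It serves both
  for locating points relative to a cap and for showing that an affine map is fixed by its values at
  three points.\<close>

lemma barycentric_orient:
  assumes "orient q p v \<noteq> 0"
  shows "z = (orient q z v / orient q p v) *\<^sub>R p + (orient z p v / orient q p v) *\<^sub>R q
     + (orient q p z / orient q p v) *\<^sub>R v"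
proof -
  have "orient q p v *\<^sub>R z = orient q z v *\<^sub>R p + orient z p v *\<^sub>R q + orient q p z *\<^sub>R v"
    by (simp add: vec_eq_iff forall_2 orient_def cross2_def) (simp add: algebra_simps)
  then have "(1 / orient q p v) *\<^sub>R (orient q p v *\<^sub>R z) =
     (1 / orient q p v) *\<^sub>R (orient q z v *\<^sub>R p + orient z p v *\<^sub>R q + orient q p z *\<^sub>R v)" by simp
  then show ?thesis using assms by (simp add: scaleR_add_right)
qed

lemma orient_sum: "orient q z v + orient z p v + orient q p z = orient q p v"
  by (simp add: orient_def cross2_def algebra_simps)

text \<open>Seen from \<open>v\<close>, the set \<open>Q\<close> lies in the angle spanned by \<open>p\<close> and \<open>q\<close> and behind the line
  \<open>p q\<close>, so every segment from \<open>v\<close> to \<open>Q\<close> enters \<open>Q\<close> at the latest on the segment \<open>p q\<close>.\<close>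

lemma convex_hull_insert_cap:
  assumes "convex Q" "p \<in> Q" "q \<in> Q" and pos: "0 < orient q p v"
    and Q: "\<And>z. z \<in> Q \<Longrightarrow> 0 \<le> orient q z v" "\<And>z. z \<in> Q \<Longrightarrow> 0 \<le> orient z p v"
       "\<And>z. z \<in> Q \<Longrightarrow> orient q p z \<le> 0"
  shows "convex hull (insert v Q) = Q \<union> convex hull {q, p, v}"
proof
  show "Q \<union> convex hull {q, p, v} \<subseteq> convex hull (insert v Q)"
    using assms(2,3) hull_mono[of "{q, p, v}" "insert v Q" convex] by (auto intro: hull_inc)
  show "convex hull (insert v Q) \<subseteq> Q \<union> convex hull {q, p, v}"
  proof
    fix x assume "x \<in> convex hull (insert v Q)"
    then obtain u w z where z: "0 \<le> u" "0 \<le> w" "u + w = 1" "z \<in> Q" "x = u *\<^sub>R v + w *\<^sub>R z"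
      using convex_hull_insert[of Q v] assms(1,2) by (auto simp: hull_same)
    define s t where "s = orient q z v / orient q p v" and "t = orient z p v / orient q p v"
    have st: "0 \<le> s" "0 \<le> t" using Q z pos by (simp_all add: s_def t_def)
    have r: "orient q p z / orient q p v = 1 - s - t"
      using orient_sum[of q z v p] pos by (simp add: s_def t_def eq_diff_eq add_divide_distrib[symmetric] add.commute add.left_commute)
    have zz: "z = s *\<^sub>R p + t *\<^sub>R q + (1 - s - t) *\<^sub>R v"
      using barycentric_orient[of q p v z] pos unfolding s_def[symmetric] t_def[symmetric] r by simp
    have "1 - s - t \<le> 0" using Q(3)[OF z(4)] pos unfolding r[symmetric] by (simp add: divide_nonpos_pos)
    then have ge: "1 \<le> s + t" by simp
    show "x \<in> Q \<union> convex hull {q, p, v}"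
    proof (cases "w * (s + t) \<le> 1")
      case True
      have "x = (w * t) *\<^sub>R q + (w * s) *\<^sub>R p + (1 - w * (s + t)) *\<^sub>R v"
        using z(3) unfolding z(5) zz by (simp add: algebra_simps flip: scaleR_add_left)
      moreover have "0 \<le> w * t" "0 \<le> w * s" "0 \<le> 1 - w * (s + t)" "w * t + w * s + (1 - w * (s + t)) = 1"
        using True z st by (auto simp: algebra_simps)
      ultimately have "x \<in> convex hull {q, p, v}" unfolding convex_hull_3 by blast
      then show ?thesis ..
    next
      case False
      have "w \<le> 1" using z by simp
      then have "w * (s + t) \<le> 1 * (s + t)" by (rule mult_right_mono) (use st in simp)
      then have gt: "1 < s + t" using False by simp
      \<comment> \<open>\<open>m\<close> is the point where the segment from \<open>v\<close> to
        \<open>z\<close> crosses the segment \<open>p q\<close>; \<open>x\<close> lies beyond it,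
        and \<open>k\<close> is its position between \<open>m\<close> and \<open>z\<close>.\<close>
      define m where "m = (s / (s + t)) *\<^sub>R p + (t / (s + t)) *\<^sub>R q"
      define k where "k = (w * (s + t) - 1) / (s + t - 1)"
      have m: "m \<in> Q"
        unfolding m_def by (rule convexD[OF assms(1-3)]) (use st gt in \<open>auto simp: add_divide_distrib[symmetric]\<close>)
      have k: "0 \<le> k" "k \<le> 1" using False gt \<open>w * (s + t) \<le> 1 * (s + t)\<close> by (auto simp: k_def)
      have "(1 - k) / (s + t) + k = w"
        using gt by (simp add: k_def divide_simps) (simp add: algebra_simps)
      moreover have "m = (1 / (s + t)) *\<^sub>R z + (1 - 1 / (s + t)) *\<^sub>R v"
      proof -
        have "(1 / (s + t)) *\<^sub>R z = (s / (s + t)) *\<^sub>R p + (t / (s + t)) *\<^sub>R q + ((1 - s - t) / (s + t)) *\<^sub>R v"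
          by (subst zz) (simp add: scaleR_add_right)
        moreover have "(1 - s - t) / (s + t) = - (1 - 1 / (s + t))" using gt by (simp add: field_simps)
        ultimately show ?thesis unfolding m_def by (simp del: minus_diff_eq)
      qed
      moreover have "(1 - k) *\<^sub>R m + k *\<^sub>R z = ((1 - k) / (s + t) + k) *\<^sub>R z + ((1 - k) - (1 - k) / (s + t)) *\<^sub>R v"
        unfolding calculation(2) by (simp add: algebra_simps)
      moreover have "(1 - k) - (1 - k) / (s + t) = u" using calculation(1) z(3) by simp
      ultimately have "x = (1 - k) *\<^sub>R m + k *\<^sub>R z" using z(5) by simp
      then have "x \<in> Q" using convexD[OF assms(1) m z(4), of "1 - k" k] k by simp
      then show ?thesis ..
    qed
  qed
qed

lemma measure_triangle: "measure lebesgue (convex hull {a, b, c}) = \<bar>orient a b c\<bar> / 2"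
proof -
  have "measure lebesgue (convex hull {a, b, c}) = measure lborel (convex hull {a, b, c})"
    by (rule measure_completion) (simp add: borel_compact finite_imp_compact_convex_hull)
  then show ?thesis unfolding content_triangle by (simp add: orient_def cross2_def algebra_simps abs_minus_commute)
qed

lemma lmeasurable_hull: "finite S \<Longrightarrow> convex hull (S :: (real ^ 'n) set) \<in> lmeasurable"
  by (simp add: finite_imp_compact_convex_hull lmeasurable_compact)

text \<open>The old hull and the new triangle lie on opposite sides of the line through
  \<open>q\<close> and \<open>p\<close>, so they overlap in a null set. It suffices to impose the
  sign conditions on the generators because half-planes are convex.\<close>

lemma measure_convex_hull_insert_cap:
  assumes "finite S" "p \<in> S" "q \<in> S" and pos: "0 < orient q p v"
    and S: "\<And>z. z \<in> S \<Longrightarrow> 0 \<le> orient q z v" "\<And>z. z \<in> S \<Longrightarrow> 0 \<le> orient z p v"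
       "\<And>z. z \<in> S \<Longrightarrow> orient q p z \<le> 0"
  shows "measure lebesgue (convex hull (insert v S)) = measure lebesgue (convex hull S) + orient q p v / 2"
proof -
  let ?Q = "convex hull S" and ?T = "convex hull {q, p, v}"
  have Q: "0 \<le> orient q z v" "0 \<le> orient z p v" "orient q p z \<le> 0" if "z \<in> ?Q" for z
  proof -
    have "0 \<le> orient v q z" using S(1) by (intro orient_ge_hull[OF _ that]) (metis orient_rotate)
    then show "0 \<le> orient q z v" by (metis orient_rotate)
    have "0 \<le> orient p v z" using S(2) by (intro orient_ge_hull[OF _ that]) (metis orient_rotate)
    then show "0 \<le> orient z p v" by (metis orient_rotate)
    have "0 \<le> orient p q z" 
      using S(3) by (intro orient_ge_hull[OF _ that]) (metis orient_swap neg_0_le_iff_le)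
    then show "orient q p z \<le> 0" using orient_swap[of q p z] by simp
  qed
  have pq: "p \<in> ?Q" "q \<in> ?Q" using assms by (auto intro: hull_inc)
  have "convex hull (insert v S) = convex hull (insert v ?Q)"
    by (metis hull_insert)
  also have "\<dots> = ?Q \<union> ?T"
    by (rule convex_hull_insert_cap) (use pq pos Q in auto)
  finally have "measure lebesgue (convex hull (insert v S)) = measure lebesgue (?Q \<union> ?T)" by simp
  also have "\<dots> = measure lebesgue ?Q + measure lebesgue ?T - measure lebesgue (?Q \<inter> ?T)"
    using assms(1) by (intro measure_Un3 lmeasurable_hull) auto
  also have "measure lebesgue (?Q \<inter> ?T) = 0"
  proof -
    define c :: "real ^ 2" where "c = vector [q $ 2 - p $ 2, p $ 1 - q $ 1]"
    have "c \<noteq> 0"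
    proof
      assume "c = 0"
      then have "q $ 2 = p $ 2" "p $ 1 = q $ 1" by (auto simp: c_def vec_eq_iff forall_2)
      then show False using pos by (simp add: orient_def cross2_def)
    qed
    have "?Q \<inter> ?T \<subseteq> {z. c \<bullet> z = c \<bullet> q}"
    proof
      fix z assume z: "z \<in> ?Q \<inter> ?T"
      have "0 \<le> orient q p z"
        by (rule orient_ge_hull[of "{q, p, v}"]) (use z pos in auto)
      then have "orient q p z = 0" using Q(3)[of z] z by simp
      then show "z \<in> {z. c \<bullet> z = c \<bullet> q}" unfolding orient_eq_inner c_def by simp
    qed
    moreover have "negligible {z. c \<bullet> z = c \<bullet> q}" using \<open>c \<noteq> 0\<close> by (intro negligible_hyperplane) simp
    ultimately show ?thesis using negligible_imp_measure0 negligible_subset by blast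
  qed
  finally show ?thesis using pos by (simp add: measure_triangle)
qed

text \<open>The shoelace formula. Positivity of all triples makes the last vertex a cap over the edge
  closing up the preceding ones.\<close>

lemma measure_convex_polygon:
  fixes v :: "nat \<Rightarrow> real ^ 2"
  assumes "\<And>i j k. i < j \<Longrightarrow> j < k \<Longrightarrow> k \<le> M \<Longrightarrow> 0 < orient (v i) (v j) (v k)"
  shows "2 * measure lebesgue (convex hull (v ` {..M})) =
     (\<Sum>i<M. cross2 (v i) (v (Suc i))) + cross2 (v M) (v 0)"
  using assms
proof (induction M)
  case 0
  then show ?case using measure_triangle[of "v 0" "v 0" "v 0"] by (simp add: cross2_def)
next
  case (Suc M)
  show ?case
  proof (cases "M = 0")
    case True
    then show ?thesis using measure_triangle[of "v 1" "v 0" "v 0"]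
      by (simp add: cross2_def atMost_Suc)
  next
    case False
    have IH: "2 * measure lebesgue (convex hull (v ` {..M})) =
       (\<Sum>i<M. cross2 (v i) (v (Suc i))) + cross2 (v M) (v 0)"
      using Suc by auto
    have pos: "0 < orient (v 0) (v M) (v (Suc M))" using Suc.prems[of 0 M "Suc M"] False by simp
    have "measure lebesgue (convex hull (insert (v (Suc M)) (v ` {..M})))
       = measure lebesgue (convex hull (v ` {..M})) + orient (v 0) (v M) (v (Suc M)) / 2"
    proof (rule measure_convex_hull_insert_cap)
      fix z assume "z \<in> v ` {..M}"
      then obtain i where i: "z = v i" "i \<le> M" by auto
      show "0 \<le> orient (v 0) z (v (Suc M))"
        using Suc.prems[of 0 i "Suc M"] i by (cases "i = 0") auto
      show "0 \<le> orient z (v M) (v (Suc M))"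
        using Suc.prems[of i M "Suc M"] i by (cases "i = M") auto
      show "orient (v 0) (v M) z \<le> 0"
        using Suc.prems[of 0 i M] i orient_rotate[of "v 0" "v i" "v M"] orient_rotate[of "v i" "v M" "v 0"] orient_swap[of "v M" "v 0" "v i"] 
        by (cases "i = 0 \<or> i = M") auto
    qed (use pos in auto)
    then have "2 * measure lebesgue (convex hull (v ` {..Suc M})) = 
        2 * measure lebesgue (convex hull (v ` {..M})) + orient (v 0) (v M) (v (Suc M))"
      by (simp add: atMost_Suc)
    also have "\<dots> = (\<Sum>i<Suc M. cross2 (v i) (v (Suc i))) + cross2 (v (Suc M)) (v 0)"
      unfolding IH orient_eq_cross2 by (simp add: cross2_def)
    finally show ?thesis .
  qed
qed


subsection \<open>Lattice polygons in coordinates\<close>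

definition emb :: "int \<times> int \<Rightarrow> real ^ 2" where
  "emb p = vector [of_int (fst p), of_int (snd p)]"

lemma emb_nth [simp]: "emb p $ 1 = of_int (fst p)" "emb p $ 2 = of_int (snd p)"
  by (simp_all add: emb_def)

lemma inj_emb: "inj emb"
  by (rule injI) (auto simp: vec_eq_iff forall_2 prod_eq_iff)

lemma emb_diff: "emb (p - q) = emb p - emb q"
  by (simp add: vec_eq_iff forall_2)

lemma emb_uminus: "emb (- p) = - emb p"
  by (simp add: vec_eq_iff forall_2)

lemma int_lattice_eq: "(int_lattice :: (real ^ 2) set) = range emb"
proof
  show "range emb \<subseteq> int_lattice"
    by (auto simp: int_lattice_def forall_2)
  show "(int_lattice :: (real ^ 2) set) \<subseteq> range emb"
  proof
    fix v :: "real ^ 2" assume "v \<in> int_lattice"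
    then obtain x y where "v $ 1 = of_int x" "v $ 2 = of_int y"
      by (auto simp: int_lattice_def forall_2 elim!: Ints_cases)
    then have "v = emb (x, y)" by (simp add: vec_eq_iff forall_2)
    then show "v \<in> range emb" by blast
  qed
qed

definition poly_hull :: "(int \<times> int) set \<Rightarrow> (real ^ 2) set" where
  "poly_hull S = convex hull (emb ` S)"

lemma lattice_polytope_eq: "lattice_polytope (P :: (real ^ 2) set) \<longleftrightarrow> (\<exists>S. finite S \<and> P = poly_hull S)"
  unfolding lattice_polytope_def int_lattice_eq poly_hull_def
  by (metis finite_imageI finite_subset_image image_mono subset_UNIV)

text \<open>Stated outside \<open>cs_equiv_rel m\<close>, because the hulls that represent classes
  in a box are compared without being placed in \<open>cs_polytopes m\<close>.\<close>

lemma lattice_equivalent_trans: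
  assumes "lattice_equivalent P Q" "lattice_equivalent Q R"
  shows "lattice_equivalent P R"
proof -
  obtain \<sigma> \<tau> where \<sigma>: "affine_transformation \<sigma>" "\<sigma> ` int_lattice = int_lattice" "\<sigma> ` P = Q"
    and \<tau>: "affine_transformation \<tau>" "\<tau> ` int_lattice = int_lattice" "\<tau> ` Q = R"
    using assms unfolding lattice_equivalent_def by blast
  have "(\<tau> \<circ> \<sigma>) ` int_lattice = int_lattice" "(\<tau> \<circ> \<sigma>) ` P = R"
    using \<sigma> \<tau> by (simp_all only: image_comp[symmetric])
  then show ?thesis
    using affine_transformation_comp[OF \<sigma>(1) \<tau>(1)] unfolding lattice_equivalent_def by blast
qed

lemma lattice_equivalent_sym:
  assumes "lattice_equivalent P Q" shows "lattice_equivalent Q P"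
proof -
  obtain \<sigma> where \<sigma>: "affine_transformation \<sigma>" "\<sigma> ` int_lattice = int_lattice" "\<sigma> ` P = Q"
    using assms unfolding lattice_equivalent_def by blast
  have inj: "inj \<sigma>" using affine_transformation_bij[OF \<sigma>(1)] by (rule bij_is_inj)
  have "inv \<sigma> ` int_lattice = int_lattice" "inv \<sigma> ` Q = P"
    using inj \<sigma>(2,3) by (metis image_inv_f_f)+
  then show ?thesis
    using affine_transformation_inv[OF \<sigma>(1)] unfolding lattice_equivalent_def by blast
qed

subsection \<open>Vertices of a lattice polygon\<close>

text \<open>A generating set of least cardinality has no redundant point: dropping one would leave a
  smaller generating set.\<close>

lemma minimal_generators:
  assumes "finite S"
  obtains T where "T \<subseteq> S" "poly_hull T = poly_hull S" "\<And>p. p \<in> T \<Longrightarrow> emb p \<notin> poly_hull (T - {p})"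
proof -
  define A where "A T \<longleftrightarrow> T \<subseteq> S \<and> poly_hull T = poly_hull S" for T
  have "A S" by (simp add: A_def)
  then obtain T where T: "A T" "\<And>U. A U \<Longrightarrow> card T \<le> card U"
    using ex_has_least_nat[of A S card] by blast
  have "emb p \<notin> poly_hull (T - {p})" if "p \<in> T" for p
  proof
    assume "emb p \<in> poly_hull (T - {p})"
    then have "convex hull (insert (emb p) (emb ` (T - {p}))) = poly_hull (T - {p})"
      unfolding poly_hull_def by (rule hull_redundant)
    moreover have "insert (emb p) (emb ` (T - {p})) = emb ` T" using that by auto
    ultimately have "A (T - {p})" using T(1) by (auto simp: A_def poly_hull_def)
    moreover have "card (T - {p}) < card T"
      using T(1) assms that by (intro card_Diff1_less) (auto simp: A_def intro: finite_subset)
    ultimately show False using T(2) by fastforce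
  qed
  then show ?thesis using T(1) that by (auto simp: A_def)
qed

text \<open>Separation from the hull of the other points gives some exposing functional. Finitely
  many strict inequalities survive a small perturbation, and adding the same small \<open>e\<close>
  to both coefficients makes both nonzero, so that each vertex acquires a definite pattern of
  signs.\<close>

lemma exposed_generic:
  assumes "finite T" "emb p \<notin> poly_hull (T - {p})"
  obtains \<alpha> \<beta> :: real where "\<alpha> \<noteq> 0" "\<beta> \<noteq> 0"
    "\<And>q. q \<in> T - {p} \<Longrightarrow> \<alpha> * fst q + \<beta> * snd q < \<alpha> * fst p + \<beta> * snd p"
proof -
  have "closed (poly_hull (T - {p}))"
    unfolding poly_hull_def using assms by (intro compact_imp_closed finite_imp_compact_convex_hull) auto
  then obtain a b where ab: "a \<bullet> emb p < b" "\<And>x. x \<in> poly_hull (T - {p}) \<Longrightarrow> b < a \<bullet> x"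
    using separating_hyperplane_closed_point[of "poly_hull (T - {p})" "emb p"] assms
    unfolding poly_hull_def by (metis convex_convex_hull)
  define \<alpha> \<beta> where "\<alpha> = - a $ 1" and "\<beta> = - a $ 2"
  have s: "\<alpha> * (fst q - fst p) + \<beta> * (snd q - snd p) < 0" if "q \<in> T - {p}" for q
  proof -
    have "emb q \<in> poly_hull (T - {p})" unfolding poly_hull_def using that by (auto intro: hull_inc)
    then have "a \<bullet> emb p < a \<bullet> emb q" using ab by fastforce
    then show ?thesis by (simp add: \<alpha>_def \<beta>_def inner_vec_def sum_2 algebra_simps)
  qed
  have ne: "eventually (\<lambda>e. c + e \<noteq> 0) (at 0)" for c :: real
  proof (cases "c = 0")
    case True
    then show ?thesis by (auto simp: eventually_at intro: exI[of _ 1])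
  next
    case False
    have "((\<lambda>e. c + e) \<longlongrightarrow> c + 0) (at 0)" by (intro tendsto_intros)
    then show ?thesis by (rule tendsto_imp_eventually_ne) (use False in simp)
  qed
  have "eventually (\<lambda>e. (\<alpha> + e) * (fst q - fst p) + (\<beta> + e) * (snd q - snd p) < 0) (at 0)"
    if "q \<in> T - {p}" for q
  proof -
    have "((\<lambda>e. (\<alpha> + e) * (fst q - fst p) + (\<beta> + e) * (snd q - snd p)) \<longlongrightarrow>
       (\<alpha> + 0) * (fst q - fst p) + (\<beta> + 0) * (snd q - snd p)) (at 0)"
      by (intro tendsto_intros)
    then show ?thesis by (rule order_tendstoD) (use s[OF that] in simp)
  qed
  then have "eventually (\<lambda>e. \<forall>q\<in>T-{p}. (\<alpha> + e) * (fst q - fst p) + (\<beta> + e) * (snd q - snd p) < 0) (at 0)"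
    using assms(1) by (intro eventually_ball_finite) auto
  then have "eventually (\<lambda>e. \<alpha> + e \<noteq> 0 \<and> \<beta> + e \<noteq> 0 \<and>
     (\<forall>q\<in>T-{p}. (\<alpha> + e) * (fst q - fst p) + (\<beta> + e) * (snd q - snd p) < 0)) (at 0)"
    using ne[of \<alpha>] ne[of \<beta>] by eventually_elim auto
  then obtain e where e: "\<alpha> + e \<noteq> 0" "\<beta> + e \<noteq> 0"
     "\<forall>q\<in>T-{p}. (\<alpha> + e) * (fst q - fst p) + (\<beta> + e) * (snd q - snd p) < 0"
    using eventually_happens[of _ "at (0::real)"] by (auto simp: trivial_limit_at)
  show ?thesis
  proof (rule that[of "\<alpha> + e" "\<beta> + e"])
    fix q assume "q \<in> T - {p}"
    then have "(\<alpha> + e) * (fst q - fst p) + (\<beta> + e) * (snd q - snd p) < 0" using e(3) by blast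
    then show "(\<alpha> + e) * fst q + (\<beta> + e) * snd q < (\<alpha> + e) * fst p + (\<beta> + e) * snd p"
      by (simp add: right_diff_distrib)
  qed (use e in auto)
qed

definition reflect :: "int \<Rightarrow> int \<Rightarrow> int \<times> int \<Rightarrow> int \<times> int" where
  "reflect s t p = (s * fst p, t * snd p)"

lemma reflect_reflect: "s * s = 1 \<Longrightarrow> t * t = 1 \<Longrightarrow> reflect s t (reflect s t p) = p"
  by (simp add: reflect_def prod_eq_iff flip: mult.assoc)

text \<open>Recovers a vertex set from four chains in standard position. Chains may share points and
  different quadruples may give the same set; for an upper bound it is enough that every vertex set
  arises.\<close>

definition assemble ::
  "(int \<times> int) set \<times> (int \<times> int) set \<times> (int \<times> int) set \<times> (int \<times> int) set \<Rightarrow> (int \<times> int) set" where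
  "assemble = (\<lambda>(C1, C2, C3, C4). reflect 1 1 ` C1 \<union> reflect 1 (-1) ` C2 \<union> reflect (-1) 1 ` C3 \<union> reflect (-1) (-1) ` C4)"

text \<open>The vertices split into four chains according to the signs of the coefficients of an
  exposing functional.\<close>

lemma poly_hull_assemble:
  assumes "finite S" "S \<subseteq> {-a..a} \<times> {-b..b}"
  obtains D where "D \<in> ne_chains a b \<times> ne_chains a b \<times> ne_chains a b \<times> ne_chains a b"
    "poly_hull S = poly_hull (assemble D)"
proof -
  obtain T where T: "T \<subseteq> S" "poly_hull T = poly_hull S" "\<And>p. p \<in> T \<Longrightarrow> emb p \<notin> poly_hull (T - {p})"
    using minimal_generators[OF assms(1)] by blast
  have finT: "finite T" using T(1) assms(1) by (rule finite_subset)
  define U where "U s t = {p :: int \<times> int. p \<in> T \<and> (\<exists>(\<alpha>::real) (\<beta>::real). 0 < \<alpha> \<and> 0 < \<beta> \<and>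
     (\<forall>q\<in>T-{p}. \<alpha> * of_int s * of_int (fst q) + \<beta> * of_int t * of_int (snd q) < \<alpha> * of_int s * of_int (fst p) + \<beta> * of_int t * of_int (snd p)))}"
    for s t :: int
  define C where "C s t = reflect s t ` U s t" for s t
  have C: "C s t \<in> ne_chains a b" if st: "s \<in> {1, -1}" "t \<in> {1, -1}" for s t
  proof -
    have "C s t \<subseteq> {-a..a} \<times> {-b..b}"
    proof
      fix x assume "x \<in> C s t"
      then obtain p where p: "p \<in> T" "x = reflect s t p" by (auto simp: C_def U_def)
      have "p \<in> {-a..a} \<times> {-b..b}" using p T(1) assms(2) by blast
      then show "x \<in> {-a..a} \<times> {-b..b}" using st by (auto simp: p reflect_def mem_Times_iff)
    qed
    moreover have "ne_chain (C s t)"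
      unfolding ne_chain_def
    proof
      fix x assume "x \<in> C s t"
      then obtain p where p: "p \<in> U s t" "x = reflect s t p" by (auto simp: C_def)
      then have "\<exists>(\<alpha>::real) (\<beta>::real). 0 < \<alpha> \<and> 0 < \<beta> \<and>
         (\<forall>q\<in>T-{p}. \<alpha> * of_int s * of_int (fst q) + \<beta> * of_int t * of_int (snd q) < \<alpha> * of_int s * of_int (fst p) + \<beta> * of_int t * of_int (snd p))"
        unfolding U_def mem_Collect_eq by (elim conjE)
      then obtain \<alpha> \<beta> :: real where ab: "0 < \<alpha>" "0 < \<beta>"
        "\<forall>q\<in>T-{p}. \<alpha> * of_int s * of_int (fst q) + \<beta> * of_int t * of_int (snd q) < \<alpha> * of_int s * of_int (fst p) + \<beta> * of_int t * of_int (snd p)"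
        by (elim exE conjE)
      have "\<alpha> * fst y + \<beta> * snd y < \<alpha> * fst x + \<beta> * snd x" if y: "y \<in> C s t - {x}" for y
      proof -
        obtain q where "q \<in> U s t" "y = reflect s t q" using y unfolding C_def by blast
        then have q: "q \<in> T - {p}" "y = reflect s t q" using y p by (auto simp: U_def)
        show ?thesis using bspec[OF ab(3) q(1)] by (simp add: q p reflect_def mult.assoc)
      qed
      then show "\<exists>(\<alpha>::real) (\<beta>::real). 0 < \<alpha> \<and> 0 < \<beta> \<and> (\<forall>q\<in>C s t - {x}. \<alpha> * fst q + \<beta> * snd q < \<alpha> * fst x + \<beta> * snd x)"
        using ab by blast
    qed
    ultimately show ?thesis by (simp add: ne_chains_def)
  qed
  have RC: "reflect s t ` C s t = U s t" if "s \<in> {1, -1}" "t \<in> {1, -1}" for s t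
  proof -
    have "reflect s t (reflect s t p) = p" for p using that by (intro reflect_reflect) auto
    then show ?thesis by (simp add: C_def image_image)
  qed
  have "T \<subseteq> U 1 1 \<union> U 1 (-1) \<union> U (-1) 1 \<union> U (-1) (-1)"
  proof
    fix p assume p: "p \<in> T"
    obtain \<alpha> \<beta> :: real where ab: "\<alpha> \<noteq> 0" "\<beta> \<noteq> 0"
      "\<And>q. q \<in> T - {p} \<Longrightarrow> \<alpha> * fst q + \<beta> * snd q < \<alpha> * fst p + \<beta> * snd p"
      using exposed_generic[OF finT T(3)[OF p]] by blast
    define s t :: int where "s = (if \<alpha> > 0 then 1 else -1)" and "t = (if \<beta> > 0 then 1 else -1)"
    have "\<bar>\<alpha>\<bar> * of_int s = \<alpha>" "\<bar>\<beta>\<bar> * of_int t = \<beta>" "0 < \<bar>\<alpha>\<bar>" "0 < \<bar>\<beta>\<bar>" using ab by (auto simp: s_def t_def)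
    then have "\<exists>(\<alpha>'::real) (\<beta>'::real). 0 < \<alpha>' \<and> 0 < \<beta>' \<and>
        (\<forall>q\<in>T-{p}. \<alpha>' * of_int s * of_int (fst q) + \<beta>' * of_int t * of_int (snd q)
          < \<alpha>' * of_int s * of_int (fst p) + \<beta>' * of_int t * of_int (snd p))"
      using ab(3) by (intro exI[of _ "\<bar>\<alpha>\<bar>"] exI[of _ "\<bar>\<beta>\<bar>"]) simp
    then have "p \<in> U s t" using p unfolding U_def by simp
    then show "p \<in> U 1 1 \<union> U 1 (-1) \<union> U (-1) 1 \<union> U (-1) (-1)" by (auto simp: s_def t_def split: if_splits)
  qed
  moreover have "U s t \<subseteq> T" for s t by (auto simp: U_def)
  ultimately have "T = U 1 1 \<union> U 1 (-1) \<union> U (-1) 1 \<union> U (-1) (-1)" by blast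
  then have "assemble (C 1 1, C 1 (-1), C (-1) 1, C (-1) (-1)) = T"
    using RC by (simp add: assemble_def)
  then show ?thesis using that[of "(C 1 1, C 1 (-1), C (-1) 1, C (-1) (-1))"] C T(2) by simp
qed

subsection \<open>Reduction to a box\<close>

definition int_map :: "int \<Rightarrow> int \<Rightarrow> int \<Rightarrow> int \<Rightarrow> int \<times> int \<Rightarrow> int \<times> int" where
  "int_map p q r s z = (p * fst z + q * snd z, r * fst z + s * snd z)"

lemma unimodular_image:
  fixes p q r s :: int
  assumes D: "\<bar>p * s - q * r\<bar> = 1" and "finite S"
  defines "S' \<equiv> int_map p q r s ` S"
  shows "lattice_equivalent (poly_hull S) (poly_hull S')"
    and "measure lebesgue (poly_hull S') = measure lebesgue (poly_hull S)"
    and "0 \<in> poly_hull S \<Longrightarrow> 0 \<in> poly_hull S'"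
proof -
  define A :: "real ^ 2 ^ 2" where "A = vector [vector [p, q], vector [r, s]]"
  define G where "G = (*v) A"
  have lin: "linear G" by (simp add: G_def)
  have det: "det A = of_int (p * s - q * r)" by (simp add: det_2 A_def)
  then have absdet: "\<bar>det A\<bar> = 1" using D by (metis of_int_1 of_int_abs)
  then have "invertible A" by (simp add: invertible_det_nz)
  then have "inj G" unfolding G_def by (rule inj_matrix_vector_mult)
  then have bij: "bij G" using lin linear_injective_imp_surjective bij_def by blast
  have G: "G (emb z) = emb (int_map p q r s z)" for z
    by (simp add: vec_eq_iff forall_2 G_def A_def matrix_vector_mult_def sum_2 int_map_def)
  have DD: "(p * s - q * r) * (p * s - q * r) = 1" 
    using D by (metis abs_mult_self_eq mult_1)
  have "surj (int_map p q r s)"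
  \<comment> \<open>The preimage is the determinant times the adjugate applied to \<open>z\<close>;
    a determinant of absolute value 1 is its own inverse.\<close>
  proof (rule surjI)
    fix z :: "int \<times> int"
    let ?D = "p * s - q * r"
    have "p * (?D * (s * fst z - q * snd z)) + q * (?D * (p * snd z - r * fst z)) = ?D * ?D * fst z"
         "r * (?D * (s * fst z - q * snd z)) + s * (?D * (p * snd z - r * fst z)) = ?D * ?D * snd z"
      by (simp_all add: algebra_simps)
    then show "int_map p q r s (?D * (s * fst z - q * snd z), ?D * (p * snd z - r * fst z)) = z"
      unfolding DD by (simp add: int_map_def prod_eq_iff)
  qed
  then have "G ` int_lattice = int_lattice"
    unfolding int_lattice_eq image_image G by (metis image_image)
  moreover have img: "G ` poly_hull S = poly_hull S'"
    unfolding poly_hull_def S'_def convex_hull_linear_image[OF lin] image_image G ..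
  moreover have "affine_transformation G"
    unfolding affine_transformation_def by (rule exI[of _ G], rule exI[of _ 0]) (use lin bij in auto)
  ultimately show "lattice_equivalent (poly_hull S) (poly_hull S')"
    unfolding lattice_equivalent_def by blast
  show "measure lebesgue (poly_hull S') = measure lebesgue (poly_hull S)"
    unfolding img[symmetric]
    using measure_linear_image[OF lin, of "poly_hull S"] lmeasurable_hull[of "emb ` S"] assms(2) absdet
    by (simp add: poly_hull_def G_def)
  show "0 \<in> poly_hull S'" if "0 \<in> poly_hull S"
    unfolding img[symmetric] using that linear_0[OF lin] by (metis image_eqI)
qed

text \<open>The centre is the midpoint of any point of \<open>P\<close> and its mirror image, hence
  lies in \<open>P\<close>; as a lattice point it can be translated to the origin.\<close>

lemma centre_at_origin:
  fixes P :: "(real ^ 2) set"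
  assumes "P \<in> cs_polytopes m" "0 < m"
  obtains S where "finite S" "lattice_equivalent P (poly_hull S)" "0 \<in> poly_hull S"
    "measure lebesgue (poly_hull S) = measure lebesgue P"
proof -
  obtain c where c: "c \<in> range emb" "(\<lambda>x. 2 *\<^sub>R c - x) ` P = P"
    using assms by (auto simp: cs_polytopes_def centrally_symmetric_def int_lattice_eq)
  then obtain c0 where c0: "c = emb c0" by blast
  have "measure lebesgue P \<noteq> 0" using assms by (auto simp: cs_polytopes_def)
  then have "P \<noteq> {}" by auto
  then obtain x where x: "x \<in> P" by blast
  obtain S where S: "finite S" "P = poly_hull S"
    using assms by (auto simp: cs_polytopes_def full_dim_lattice_polytope_def lattice_polytope_eq)
  have "2 *\<^sub>R c - x \<in> P" using x c(2) by blast
  moreover have "convex P" by (simp add: S poly_hull_def)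
  ultimately have "(1/2) *\<^sub>R x + (1/2) *\<^sub>R (2 *\<^sub>R c - x) \<in> P" using x by (intro convexD) auto
  then have cP: "c \<in> P" by (simp add: scaleR_diff_right)
  define S' where "S' = (\<lambda>p. p - c0) ` S"
  have "emb ` S' = (\<lambda>x. - c + x) ` emb ` S"
    by (simp add: S'_def image_image emb_diff c0)
  then have P': "poly_hull S' = (\<lambda>x. - c + x) ` P"
    by (simp only: poly_hull_def S(2) convex_hull_translation)
  have "affine_transformation (\<lambda>x. - c + x)"
    unfolding affine_transformation_def
    by (rule exI[of _ "\<lambda>x. x"], rule exI[of _ "- c"]) (auto simp: linear_ident bij_def)
  moreover have "(\<lambda>x. - c + x) ` int_lattice = int_lattice"
  proof -
    have "(\<lambda>x. - c + x) ` int_lattice = emb ` ((\<lambda>p. p - c0) ` UNIV)"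
      unfolding int_lattice_eq image_image by (simp add: emb_diff c0)
    also have "(\<lambda>p. p - c0) ` UNIV = UNIV" by (rule surjI[of _ "\<lambda>p. p + c0"]) simp
    finally show ?thesis by (simp add: int_lattice_eq)
  qed
  ultimately have "lattice_equivalent P (poly_hull S')"
    unfolding lattice_equivalent_def P' by blast
  moreover have "0 \<in> poly_hull S'" unfolding P' using cP by (auto intro: image_eqI[of _ _ c])
  moreover have "measure lebesgue (poly_hull S') = measure lebesgue P"
    unfolding P' by (rule measure_translation)
  ultimately show ?thesis using that[of S'] S(1) by (auto simp: S'_def)
qed

text \<open>Division with the remainder of least absolute value; \<open>sgn x\<close> turns
  multiples of \<bar>x\<bar> into multiples of \<open>x\<close>.\<close>

lemma shear_reduce:
  fixes x y :: int
  assumes "x \<noteq> 0"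
  obtains k where "2 * \<bar>y + k * x\<bar> \<le> \<bar>x\<bar>"
proof -
  define r where "r = y mod \<bar>x\<bar>"
  have r: "0 \<le> r" "r < \<bar>x\<bar>" using assms by (simp_all add: r_def)
  have y: "y = r + (y div \<bar>x\<bar>) * \<bar>x\<bar>" by (simp add: r_def)
  have s: "sgn x * x = \<bar>x\<bar>" by (simp add: sgn_mult_self_eq abs_sgn mult.commute)
  show ?thesis
  proof (cases "2 * r \<le> \<bar>x\<bar>")
    case True
    have "y + (- (y div \<bar>x\<bar>) * sgn x) * x = r" using y s by (simp add: mult.assoc)
    then show ?thesis using True r that[of "- (y div \<bar>x\<bar>) * sgn x"] by simp
  next
    case False
    have "y + ((- (y div \<bar>x\<bar>) - 1) * sgn x) * x = y + (- (y div \<bar>x\<bar>) - 1) * \<bar>x\<bar>" 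
      using s by (simp add: mult.assoc)
    also have "\<dots> = r - \<bar>x\<bar>" using y by (simp add: left_diff_distrib)
    finally have "2 * \<bar>y + ((- (y div \<bar>x\<bar>) - 1) * sgn x) * x\<bar> \<le> \<bar>x\<bar>" using False r by simp
    then show ?thesis by (rule that)
  qed
qed

lemma box_representative:
  fixes P :: "(real ^ 2) set"
  assumes P: "P \<in> cs_polytopes m" "0 < m"
  obtains a b :: int and S where "finite S" "lattice_equivalent P (poly_hull S)"
    "S \<subseteq> {-a..a} \<times> {-b..b}" "1 \<le> a" "1 \<le> b" "a * b \<le> 2 * int m"
proof -
  define good where "good S \<longleftrightarrow> finite S \<and> lattice_equivalent P (poly_hull S) \<and> 0 \<in> poly_hull S \<and>
     measure lebesgue (poly_hull S) = real m / 2" for S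
  define w where "w S = Max ((\<lambda>p. \<bar>fst p\<bar>) ` S)" for S :: "(int \<times> int) set"
  define h where "h S = Max ((\<lambda>p. \<bar>snd p\<bar>) ` S)" for S :: "(int \<times> int) set"
  have "measure lebesgue P = real m / 2" using P by (simp add: cs_polytopes_def)
  then obtain S0 where "good S0" using centre_at_origin[OF P] unfolding good_def by metis
  then obtain S where S: "good S" "\<And>T. good T \<Longrightarrow> nat (w S) \<le> nat (w T)"
    using ex_has_least_nat[of good S0 "\<lambda>S. nat (w S)"] by blast
  have good_image: "good (int_map p q r s ` T)" if "good T" "\<bar>p * s - q * r\<bar> = 1" for T p q r s
    using unimodular_image[OF that(2), of T] that(1) lattice_equivalent_trans unfolding good_def by auto
  have ne: "finite T" "T \<noteq> {}" if "good T" for T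
    using that by (auto simp: good_def poly_hull_def)
  have w: "\<exists>p\<in>T. \<bar>fst p\<bar> = w T" "\<And>p. p \<in> T \<Longrightarrow> \<bar>fst p\<bar> \<le> w T" if "good T" for T
  proof -
    have "w T \<in> (\<lambda>p. \<bar>fst p\<bar>) ` T" unfolding w_def using ne[OF that] by (intro Max_in) auto
    then show "\<exists>p\<in>T. \<bar>fst p\<bar> = w T" by force
    show "\<And>p. p \<in> T \<Longrightarrow> \<bar>fst p\<bar> \<le> w T" unfolding w_def using ne[OF that] by (intro Max_ge) auto
  qed
  have h: "\<exists>p\<in>T. \<bar>snd p\<bar> = h T" "\<And>p. p \<in> T \<Longrightarrow> \<bar>snd p\<bar> \<le> h T" if "good T" for T
  proof -
    have "h T \<in> (\<lambda>p. \<bar>snd p\<bar>) ` T" unfolding h_def using ne[OF that] by (intro Max_in) auto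
    then show "\<exists>p\<in>T. \<bar>snd p\<bar> = h T" by force
    show "\<And>p. p \<in> T \<Longrightarrow> \<bar>snd p\<bar> \<le> h T" unfolding h_def using ne[OF that] by (intro Max_ge) auto
  qed
  obtain p where p: "p \<in> S" "\<bar>fst p\<bar> = w S" using w(1)[OF S(1)] by blast
  have "w S \<noteq> 0"
  proof
    assume "w S = 0"
    then have z: "fst x = 0" if "x \<in> S" for x using w(2)[OF S(1) that] by simp
    have "poly_hull S \<subseteq> {z. axis 1 1 \<bullet> z = 0}"
      unfolding poly_hull_def
    proof (rule hull_minimal)
      show "emb ` S \<subseteq> {z. axis 1 1 \<bullet> z = 0}" using z by (auto simp: inner_axis')
    qed (rule convex_hyperplane)
    moreover have "negligible {z :: real ^ 2. axis 1 1 \<bullet> z = 0}"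
      by (rule negligible_hyperplane) (simp add: axis_eq_0_iff)
    ultimately have "measure lebesgue (poly_hull S) = 0"
      using negligible_imp_measure0 negligible_subset by blast
    then show False using S(1) P(2) by (simp add: good_def)
  qed
  then have w1: "1 \<le> w S" using p by linarith
  then obtain k where k: "2 * \<bar>snd p + k * fst p\<bar> \<le> \<bar>fst p\<bar>"
    using shear_reduce[of "fst p" "snd p"] p by (metis abs_0 not_one_le_zero)
  define T where "T = int_map 1 0 k 1 ` S"
  have T: "good T" unfolding T_def by (rule good_image) (use S in auto)
  \<comment> \<open>The shear keeps first coordinates, so \<open>T\<close> is still minimal for
    \<open>w\<close>.\<close>
  have wT: "w T = w S" by (simp add: w_def T_def image_image int_map_def)
  define p' where "p' = int_map 1 0 k 1 p"
  have p': "p' \<in> T" "\<bar>fst p'\<bar> = w S" "2 * \<bar>snd p'\<bar> \<le> w S"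
    using p k by (auto simp: p'_def T_def int_map_def add.commute)
  obtain q where q: "q \<in> T" "\<bar>snd q\<bar> = h T" using h(1)[OF T] by blast
  \<comment> \<open>Exchanging the coordinates is unimodular too, so minimality forces the width to
    be at most the height.\<close>
  have "good (int_map 0 1 1 0 ` T)" by (rule good_image) (use T in auto)
  then have "nat (w S) \<le> nat (w (int_map 0 1 1 0 ` T))" by (rule S(2))
  also have "w (int_map 0 1 1 0 ` T) = h T" by (simp add: w_def h_def image_image int_map_def)
  finally have wh: "w S \<le> h T" using w1 by linarith
  have "convex hull {0, emb p', emb q} \<subseteq> poly_hull T"
    unfolding poly_hull_def using T q p'
    by (intro hull_minimal) (auto simp: good_def poly_hull_def intro: hull_inc)
  then have "measure lebesgue (convex hull {0, emb p', emb q}) \<le> measure lebesgue (poly_hull T)"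
    unfolding poly_hull_def
    by (intro measure_mono_fmeasurable lmeasurable_hull fmeasurableD) (use ne[OF T] in auto)
  then have "\<bar>orient 0 (emb p') (emb q)\<bar> \<le> real m" using T by (simp add: measure_triangle good_def)
  also have "orient 0 (emb p') (emb q) = of_int (fst p' * snd q - snd p' * fst q)"
    by (simp add: orient_def cross2_def)
  finally have le: "\<bar>fst p' * snd q - snd p' * fst q\<bar> \<le> int m" by linarith
  \<comment> \<open>In the determinant of \<open>p'\<close> and \<open>q\<close> one product is
    exactly \<open>w S * h T\<close>, and the other is at most half of that by the shear. Hence half
    of \<open>w S * h T\<close> is bounded by the determinant, that is, by \<open>m\<close>.\<close>
  have "2 * \<bar>snd p' * fst q\<bar> = (2 * \<bar>snd p'\<bar>) * \<bar>fst q\<bar>" by (simp add: abs_mult)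
  also have "\<dots> \<le> w S * h T"
    by (rule mult_mono) (use p' w(2)[OF T q(1)] wT wh w1 in auto)
  finally have "2 * \<bar>snd p' * fst q\<bar> \<le> w S * h T" .
  moreover have "\<bar>fst p' * snd q\<bar> = w S * h T" using p' q by (simp add: abs_mult)
  ultimately have "w S * h T \<le> 2 * int m" using le by linarith
  moreover have "T \<subseteq> {- w S..w S} \<times> {- h T..h T}"
  proof
    fix x assume "x \<in> T"
    then have "\<bar>fst x\<bar> \<le> w S" "\<bar>snd x\<bar> \<le> h T" using w(2)[OF T] h(2)[OF T] wT by auto
    then show "x \<in> {- w S..w S} \<times> {- h T..h T}" by (auto simp: mem_Times_iff)
  qed
  ultimately show ?thesis using that[of T "w S" "h T"] T w1 wh by (auto simp: good_def)
qed

subsection \<open>The upper bound\<close>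

text \<open>The step sets have side lengths 2a and 2b with product at most 8m, whose cube root is 2
  m^(1/3); three times this gives the 6. First points number at most 9ab \<le> 18m, and the empty
  chain raises 18 to 19.\<close>

lemma card_ne_chains_bound:
  fixes a b :: int
  assumes "1 \<le> a" "1 \<le> b" "a * b \<le> 2 * int m"
  shows "real (card (ne_chains a b)) \<le> 19 * real m * exp (6 * real m powr (1/3))"
proof -
  have "1 * 1 \<le> a * b" by (rule mult_mono) (use assms in auto)
  then have m: "1 \<le> m" using assms(3) by linarith
  have "4 * (a * b) \<le> 8 * int m" using assms(3) by simp
  then have "real_of_int (4 * (a * b)) \<le> real_of_int (8 * int m)" by (simp only: of_int_le_iff)
  then have ab: "real_of_int (2 * a * (2 * b)) \<le> 8 * real m" by simp
  have "real_of_int (2 * a * (2 * b)) powr (1/3) \<le> (8 * real m) powr (1/3)"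
    by (rule powr_mono2) (use assms ab in \<open>auto simp del: of_int_mult\<close>)
  also have "\<dots> = 2 * real m powr (1/3)"
  proof -
    have "(8::real) powr (1/3) = (2 powr 3) powr (1/3)" by simp
    also have "\<dots> = 2" by (simp only: powr_powr) simp
    finally show ?thesis by (simp add: powr_mult)
  qed
  finally have e: "exp (3 * real_of_int (2 * a * (2 * b)) powr (1/3)) \<le> exp (6 * real m powr (1/3))" by simp
  have "(2 * a + 1) * (2 * b + 1) \<le> (3 * a) * (3 * b)" by (rule mult_mono) (use assms in auto)
  also have "\<dots> \<le> 18 * int m" using assms(3) by (simp add: algebra_simps)
  finally have "int (nat (2 * a + 1) * nat (2 * b + 1)) \<le> int (18 * m)" using assms by simp
  then have "nat (2 * a + 1) * nat (2 * b + 1) \<le> 18 * m" by (simp only: of_nat_le_iff)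
  then have n: "real (nat (2 * a + 1) * nat (2 * b + 1)) \<le> 18 * real m"
    by (metis of_nat_le_iff of_nat_mult of_nat_numeral)
  have "real (card (ne_chains a b)) \<le> real (1 + nat (2*a+1) * nat (2*b+1) * card (step_sets (2*a) (2*b)))"
    using card_ne_chains_le[of a b] assms by (intro of_nat_mono) auto
  also have "\<dots> = 1 + real (nat (2*a+1) * nat (2*b+1)) * real (card (step_sets (2*a) (2*b)))" by simp
  also have "\<dots> \<le> 1 + 18 * real m * exp (6 * real m powr (1/3))"
    using n order_trans[OF card_step_sets_le[of "2 * a" "2 * b"] e] assms
    by (intro add_left_mono mult_mono) (auto simp del: of_nat_mult of_int_mult)
  also have "\<dots> \<le> 19 * real m * exp (6 * real m powr (1/3))"
  proof -
    have "1 * 1 \<le> real m * exp (6 * real m powr (1/3))" by (rule mult_mono) (use m in auto)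
    then show ?thesis by simp
  qed
  finally show ?thesis .
qed

definition boxes :: "nat \<Rightarrow> (int \<times> int) set" where
  "boxes m = {(a, b). 1 \<le> a \<and> 1 \<le> b \<and> a * b \<le> 2 * int m}"

lemma boxes: "finite (boxes m)" "card (boxes m) \<le> 4 * m ^ 2"
proof -
  have sub: "boxes m \<subseteq> {1..2 * int m} \<times> {1..2 * int m}"
  proof
    fix x assume "x \<in> boxes m"
    then obtain a b where x: "x = (a, b)" "1 \<le> a" "1 \<le> b" "a * b \<le> 2 * int m" by (auto simp: boxes_def)
    have "a * 1 \<le> a * b" by (rule mult_left_mono) (use x in auto)
    moreover have "1 * b \<le> a * b" by (rule mult_right_mono) (use x in auto)
    ultimately have "a \<le> 2 * int m" "b \<le> 2 * int m" using x(4) by linarith+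
    then show "x \<in> {1..2 * int m} \<times> {1..2 * int m}" using x by auto
  qed
  then show "finite (boxes m)" by (rule finite_subset) simp
  have "card (boxes m) \<le> card ({1..2 * int m} \<times> {1..2 * int m})" by (rule card_mono[OF _ sub]) simp
  then show "card (boxes m) \<le> 4 * m ^ 2" by (simp add: card_cartesian_product power2_eq_square nat_mult_distrib)
qed

text \<open>A class is coded by a box and four chains. Classes with the same code contain polygons
  equivalent to one and the same hull, so they coincide.\<close>

lemma classes_bound:
  assumes "0 < m"
  defines "Q \<equiv> (cs_polytopes m :: (real ^ 2) set set) // cs_equiv_rel m"
  shows "finite Q" "real (card Q) \<le> 4 * real m ^ 2 * (19 * real m * exp (6 * real m powr (1/3))) ^ 4"
proof -
  define N where "N = (\<lambda>(a, b). ne_chains a b \<times> ne_chains a b \<times> ne_chains a b \<times> ne_chains a b)"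
  define D where "D = Sigma (boxes m) N"
  have finD: "finite D"
    unfolding D_def N_def using boxes(1) finite_ne_chains by (intro finite_SigmaI) auto
  have "\<exists>d\<in>D. \<exists>P\<in>X. lattice_equivalent P (poly_hull (assemble (snd d)))" if "X \<in> Q" for X
  proof -
    obtain P where P: "P \<in> cs_polytopes m" "X = cs_equiv_rel m `` {P}"
      using \<open>X \<in> Q\<close> unfolding Q_def quotient_def by auto
    have "P \<in> X" using equiv_class_self[OF equiv_cs_equiv_rel P(1)] P(2) by simp
    obtain a b S where S: "finite S" "lattice_equivalent P (poly_hull S)"
      "S \<subseteq> {-a..a} \<times> {-b..b}" "1 \<le> a" "1 \<le> b" "a * b \<le> 2 * int m"
      by (rule box_representative[OF P(1) assms(1)])
    obtain d where "d \<in> N (a, b)" "poly_hull S = poly_hull (assemble d)"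
      unfolding N_def prod.case by (rule poly_hull_assemble[OF S(1,3)])
    then show ?thesis using S \<open>P \<in> X\<close>
      by (intro bexI[of _ "((a, b), d)"] bexI[of _ P]) (auto simp: D_def boxes_def)
  qed
  then obtain F where F: "\<And>X. X \<in> Q \<Longrightarrow> F X \<in> D \<and> (\<exists>P\<in>X. lattice_equivalent P (poly_hull (assemble (snd (F X)))))"
    by metis
  have inj: "inj_on F Q"
  proof (rule inj_onI)
    fix X Y assume XY: "X \<in> Q" "Y \<in> Q" "F X = F Y"
    obtain P where P: "P \<in> X" "lattice_equivalent P (poly_hull (assemble (snd (F X))))" using F XY(1) by blast
    obtain R where R: "R \<in> Y" "lattice_equivalent R (poly_hull (assemble (snd (F X))))" using F[OF XY(2)] XY(3) by auto
    have "P \<in> cs_polytopes m" "R \<in> cs_polytopes m"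
      using XY(1,2) P(1) R(1) in_quotient_imp_subset[OF equiv_cs_equiv_rel] unfolding Q_def by blast+
    moreover have "lattice_equivalent P R"
      using P(2) R(2) lattice_equivalent_trans lattice_equivalent_sym by blast
    ultimately have "(P, R) \<in> cs_equiv_rel m" by (simp add: cs_equiv_rel_def)
    then show "X = Y"
      using quotient_eqI[OF equiv_cs_equiv_rel] XY(1,2) P(1) R(1) unfolding Q_def by blast
  qed
  have FD: "F ` Q \<subseteq> D" using F by blast
  show "finite Q" using inj FD finD by (metis finite_imageD finite_subset)
  let ?K = "19 * real m * exp (6 * real m powr (1/3))"
  have "card Q \<le> card D" using inj FD finD by (rule card_inj_on_le)
  also have "card D = (\<Sum>x\<in>boxes m. card (N x))" 
    unfolding D_def N_def using boxes(1) finite_ne_chains by (intro card_SigmaI) auto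
  finally have "real (card Q) \<le> (\<Sum>x\<in>boxes m. real (card (N x)))"
    by (metis of_nat_le_iff of_nat_sum)
  also have "\<dots> \<le> (\<Sum>x\<in>boxes m. ?K ^ 4)"
  proof (rule sum_mono)
    fix x assume "x \<in> boxes m"
    then obtain a b where x: "x = (a, b)" "1 \<le> a" "1 \<le> b" "a * b \<le> 2 * int m" by (auto simp: boxes_def)
    have "real (card (N x)) = real (card (ne_chains a b)) ^ 4"
      by (simp add: N_def x card_cartesian_product power4_eq_xxxx)
    also have "\<dots> \<le> ?K ^ 4" by (rule power_mono) (use card_ne_chains_bound[OF x(2-4)] in auto)
    finally show "real (card (N x)) \<le> ?K ^ 4" .
  qed
  also have "\<dots> = real (card (boxes m)) * ?K ^ 4" by simp
  also have "\<dots> \<le> real (4 * m ^ 2) * ?K ^ 4"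
    by (intro mult_right_mono of_nat_mono boxes(2)) simp
  finally show "real (card Q) \<le> 4 * real m ^ 2 * ?K ^ 4" by simp
qed

lemma ln_v_star_upper:
  assumes "0 < m"
  shows "ln (real (v_star TYPE(2) m)) \<le> 130 * real m powr (1/3)"
proof (cases "v_star TYPE(2) m = 0")
  case False
  define t where "t = real m powr (1/3)"
  have m: "1 \<le> real m" using assms by simp
  have t1: "1 \<le> t" unfolding t_def using m by (simp add: ge_one_powr_ge_zero)
  have "ln (real m) = 3 * ln t" using m by (simp add: t_def ln_powr)
  also have "\<dots> \<le> 3 * t" using ln_le_minus_one[of t] t1 by simp
  finally have lm: "ln (real m) \<le> 3 * t" .
  have "ln (real (v_star TYPE(2) m)) \<le> ln (4 * real m ^ 2 * (19 * real m * exp (6 * t)) ^ 4)"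
    using classes_bound(2)[OF assms] False unfolding v_star_def t_def by (intro ln_mono) auto
  also have "\<dots> = ln 4 + 2 * ln (real m) + 4 * (ln 19 + ln (real m) + 6 * t)"
    using m by (simp add: ln_mult ln_realpow)
  also have "\<dots> \<le> 3 + 6 * t + 4 * (18 + 3 * t + 6 * t)"
    using lm ln_le_minus_one[of 4] ln_le_minus_one[of 19] by simp
  also have "\<dots> \<le> 130 * t" using t1 by simp
  finally show ?thesis by (simp add: t_def)
\<comment> \<open>If there are no classes, the bound holds because \<open>ln 0 = 0\<close>.\<close>
qed simp


lemma sum_lessThan_add:
  fixes f :: "nat \<Rightarrow> 'a::comm_monoid_add"
  shows "(\<Sum>i<a + b. f i) = (\<Sum>i<a. f i) + (\<Sum>i<b. f (a + i))"
  by (induction b) (simp_all add: add.assoc)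

subsection \<open>Polygons inscribed in two opposite parabolas\<close>

lemma cross2_emb: "cross2 (emb p) (emb q) = of_int (fst p * snd q - snd p * fst q)"
  by (simp add: cross2_def)

lemma orient_emb: "orient (emb p) (emb q) (emb s) =
   of_int ((fst q - fst p) * (snd s - snd p) - (snd q - snd p) * (fst s - fst p))"
  by (simp add: orient_def cross2_def)

text \<open>The lower chain lies on \<open>y = x\<^sup>2 - H\<close>, except that its first vertex is raised by \<open>r\<close>; the upper
  chain is its mirror image in the origin. Raising the first vertex serves to adjust the area.\<close>

locale parabola_chain =
  fixes X :: "nat \<Rightarrow> int" and K :: nat and k H r :: int
  assumes X_mono: "\<And>i j. i < j \<Longrightarrow> j \<le> K \<Longrightarrow> X i < X j"
    and X_bound: "\<And>i. i \<le> K \<Longrightarrow> \<bar>X i\<bar> \<le> k"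
    and r_nonneg: "0 \<le> r"
    and H_large: "3 * k\<^sup>2 + r + k * r < H"
begin

definition lower :: "nat \<Rightarrow> int \<times> int" where
  "lower i = (X i, (X i)\<^sup>2 - H + (if i = 0 then r else 0))"

definition vert :: "nat \<Rightarrow> int \<times> int" where
  "vert i = (if i \<le> K then lower i else - lower (i - Suc K))"

definition verts :: "(int \<times> int) set" where
  "verts = vert ` {..Suc (2 * K)}"

lemma vert_lower: "i \<le> K \<Longrightarrow> vert i = lower i"
  by (simp add: vert_def)

lemma k_nonneg: "0 \<le> k" using X_bound[of 0] by simp

text \<open>On a parabola the determinant is a Vandermonde product; raising the first vertex adds a
  nonnegative term.\<close>

lemma orient_lower:
  assumes "i < j" "j < l" "l \<le> K"
  shows "0 < orient (emb (lower i)) (emb (lower j)) (emb (lower l))"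
proof -
  have d: "X i < X j" "X j < X l" "X i < X l" using assms X_mono by auto
  have e: "(fst (lower j) - fst (lower i)) * (snd (lower l) - snd (lower i)) -
     (snd (lower j) - snd (lower i)) * (fst (lower l) - fst (lower i))
     = (X j - X i) * (X l - X i) * (X l - X j) + (if i = 0 then r * (X l - X j) else 0)"
    using assms by (simp add: lower_def algebra_simps power2_eq_square)
  have "0 < (X j - X i) * (X l - X i) * (X l - X j)" using d by simp
  moreover have "0 \<le> r * (X l - X j)" using d r_nonneg by simp
  ultimately have "0 < (X j - X i) * (X l - X i) * (X l - X j) + (if i = 0 then r * (X l - X j) else 0)"
    by (cases "i = 0") (auto simp del: zero_less_mult_iff)
  then show ?thesis unfolding orient_emb e of_int_0_less_iff .
qed

text \<open>\<open>H_large\<close> is tailored to this determinant, which equals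
  \<open>d * W - ri * (X u + X i)\<close>: here W is at least 2H - 6k^2 - 2r, while the subtracted
  term is at most 2kr.\<close>

lemma orient_lower_opposite:
  assumes "i < j" "j \<le> K" "u \<le> K"
  shows "0 < orient (emb (lower i)) (emb (lower j)) (emb (- lower u))"
proof -
  define ri ru where "ri = (if i = 0 then r else 0)" and "ru = (if u = 0 then r else 0)"
  define d where "d = X j - X i"
  have d: "1 \<le> d" using X_mono[OF assms(1,2)] by (simp add: d_def)
  have b: "\<bar>X i\<bar> \<le> k" "\<bar>X j\<bar> \<le> k" "\<bar>X u\<bar> \<le> k" using X_bound assms by auto
  have r: "0 \<le> ri" "ri \<le> r" "0 \<le> ru" "ru \<le> r" using r_nonneg by (auto simp: ri_def ru_def)
  have sq: "(X i)\<^sup>2 \<le> k\<^sup>2" "(X u)\<^sup>2 \<le> k\<^sup>2" using b k_nonneg by (auto simp: abs_le_square_iff[symmetric])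
  have "\<bar>(X j + X i) * (X u + X i)\<bar> \<le> (2 * k) * (2 * k)"
    unfolding abs_mult by (rule mult_mono) (use b k_nonneg in auto)
  then have p: "- (4 * k\<^sup>2) \<le> (X j + X i) * (X u + X i)" by (simp add: power2_eq_square)
  have "ri * (X u + X i) \<le> ri * (2 * k)" by (rule mult_left_mono) (use r b in auto)
  also have "\<dots> \<le> r * (2 * k)" by (rule mult_right_mono) (use r k_nonneg in auto)
  finally have q: "ri * (X u + X i) \<le> 2 * (k * r)" by (simp add: ac_simps)
  define W where "W = 2 * H - (X u)\<^sup>2 - (X i)\<^sup>2 - ru - ri + (X j + X i) * (X u + X i)"
  have W: "2 * (k * r) < W" using H_large r p sq unfolding W_def by linarith
  have "0 \<le> k * r" using k_nonneg r_nonneg by simp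
  then have "1 * W \<le> d * W" using W d by (intro mult_right_mono) auto
  then have "0 < d * W - ri * (X u + X i)" using W q by linarith
  also have "d * W - ri * (X u + X i) = (fst (lower j) - fst (lower i)) * (snd (- lower u) - snd (lower i)) -
     (snd (lower j) - snd (lower i)) * (fst (- lower u) - fst (lower i))"
    using assms by (simp add: lower_def W_def d_def ri_def ru_def algebra_simps power2_eq_square)
  finally show ?thesis unfolding orient_emb of_int_0_less_iff .
qed

text \<open>Up to central symmetry and cyclic rotation, either all three vertices lie on the lower
  chain or exactly two of them do.\<close>

lemma orient_vert:
  assumes "i < j" "j < l" "l \<le> Suc (2 * K)"
  shows "0 < orient (emb (vert i)) (emb (vert j)) (emb (vert l))"
proof -
  consider "l \<le> K" | "j \<le> K" "K < l" | "i \<le> K" "K < j" | "K < i" using assms by linarith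
  then show ?thesis
  proof cases
    case 1
    then show ?thesis using assms orient_lower[of i j l] by (simp add: vert_def)
  next
    case 2
    then show ?thesis using assms orient_lower_opposite[of i j "l - Suc K"] by (simp add: vert_def)
  next
    case 3
    then have "0 < orient (emb (lower (j - Suc K))) (emb (lower (l - Suc K))) (emb (- lower i))"
      using assms by (intro orient_lower_opposite) auto
    also have "\<dots> = orient (- emb (lower (j - Suc K))) (- emb (lower (l - Suc K))) (- emb (- lower i))"
      by (simp only: orient_uminus)
    also have "\<dots> = orient (emb (vert j)) (emb (vert l)) (emb (vert i))"
      using 3 assms by (simp add: vert_def emb_uminus)
    finally show ?thesis by (metis orient_rotate)
  next
    case 4
    then show ?thesis using assms orient_lower[of "i - Suc K" "j - Suc K" "l - Suc K"]
      by (simp add: vert_def emb_uminus)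
  qed
qed

text \<open>Opposite edges contribute equally to the shoelace sum, which cancels its factor 2; the
  last summand is the edge joining the two chains.\<close>

lemma measure_verts:
  "measure lebesgue (poly_hull verts) =
     (\<Sum>i<K. cross2 (emb (lower i)) (emb (lower (Suc i)))) + cross2 (emb (lower 0)) (emb (lower K))"
proof -
  let ?c = "\<lambda>i. cross2 (emb (vert i)) (emb (vert (Suc i)))"
  let ?S = "\<Sum>i<K. cross2 (emb (lower i)) (emb (lower (Suc i)))"
  have neg: "cross2 (- a) (- b) = cross2 a b" "cross2 a (- b) = cross2 b a" "cross2 (- a) b = cross2 b a" for a b
    by (simp_all add: cross2_def)
  have "poly_hull verts = convex hull ((\<lambda>i. emb (vert i)) ` {..Suc (2 * K)})"
    by (simp add: poly_hull_def verts_def image_image)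
  then have "2 * measure lebesgue (poly_hull verts) =
      (\<Sum>i<Suc (2 * K). ?c i) + cross2 (emb (vert (Suc (2 * K)))) (emb (vert 0))"
    using measure_convex_polygon[of "Suc (2 * K)" "\<lambda>i. emb (vert i)"] orient_vert by simp
  also have "(\<Sum>i<Suc (2 * K). ?c i) = (\<Sum>i<Suc K. ?c i) + (\<Sum>i<K. ?c (Suc K + i))"
    using sum_lessThan_add[of ?c "Suc K" K] by (simp add: mult_2)
  also have "(\<Sum>i<Suc K. ?c i) = ?S + cross2 (emb (lower 0)) (emb (lower K))"
    by (simp add: vert_def emb_uminus neg)
  also have "(\<Sum>i<K. ?c (Suc K + i)) = ?S"
    by (rule sum.cong) (auto simp: vert_def emb_uminus neg)
  also have "cross2 (emb (vert (Suc (2 * K)))) (emb (vert 0)) = cross2 (emb (lower 0)) (emb (lower K))"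
    by (simp add: vert_def emb_uminus neg)
  finally show ?thesis by simp
qed

text \<open>Serves to tell polygons apart: a point strictly outside an edge line of one polygon
  cannot be a vertex of an equal one.\<close>

lemma edge_nonneg:
  assumes "i < Suc (2 * K)" "z \<in> poly_hull verts"
  shows "0 \<le> orient (emb (vert i)) (emb (vert (Suc i))) z"
proof (rule orient_ge_hull[OF _ assms(2)[unfolded poly_hull_def]])
  fix x assume "x \<in> emb ` verts"
  then obtain j where j: "x = emb (vert j)" "j \<le> Suc (2 * K)" by (auto simp: verts_def)
  consider "j < i" | "j = i" | "j = Suc i" | "Suc i < j" by linarith
  then show "0 \<le> orient (emb (vert i)) (emb (vert (Suc i))) x"
  proof cases
    case 1
    then have "0 < orient (emb (vert j)) (emb (vert i)) (emb (vert (Suc i)))"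
      using assms by (intro orient_vert) auto
    then show ?thesis using orient_rotate j(1) by (metis less_imp_le)
  next
    case 4
    then show ?thesis using orient_vert[of i "Suc i" j] j by (simp add: less_imp_le)
  qed (simp_all add: j)
qed

lemma finite_verts: "finite verts" by (simp add: verts_def)

lemma lower_in_hull: "i \<le> K \<Longrightarrow> emb (lower i) \<in> poly_hull verts"
  unfolding poly_hull_def verts_def by (rule hull_inc) (auto simp: vert_def intro!: image_eqI[of _ _ i])

lemma verts_eq: "verts = lower ` {..K} \<union> uminus ` lower ` {..K}"
proof -
  have "{..Suc (2 * K)} = {..K} \<union> (\<lambda>i. Suc K + i) ` {..K}"
  proof -
    have "x \<in> (\<lambda>i. Suc K + i) ` {..K}" if "x \<le> Suc (2 * K)" "\<not> x \<le> K" for x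
      using that by (intro image_eqI[of _ _ "x - Suc K"]) auto
    then show ?thesis by auto
  qed
  then have "verts = vert ` {..K} \<union> vert ` (\<lambda>i. Suc K + i) ` {..K}"
    unfolding verts_def by (simp only: image_Un)
  also have "vert ` {..K} = lower ` {..K}" by (rule image_cong) (auto simp: vert_def)
  also have "vert ` (\<lambda>i. Suc K + i) ` {..K} = uminus ` lower ` {..K}"
    unfolding image_image by (rule image_cong) (auto simp: vert_def)
  finally show ?thesis .
qed

lemma verts_box: "verts \<subseteq> {-k..k} \<times> {-H..H}"
proof -
  have "lower i \<in> {-k..k} \<times> {-H..H}" if "i \<le> K" for i
  proof -
    have b: "\<bar>X i\<bar> \<le> k" using X_bound that by auto
    then have "(X i)\<^sup>2 \<le> k\<^sup>2" by (auto simp: abs_le_square_iff[symmetric])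
    moreover have "0 \<le> k * r" using k_nonneg r_nonneg by simp
    moreover have "0 \<le> (X i)\<^sup>2" by simp
    moreover have "0 \<le> (if i = 0 then r else 0)" "(if i = 0 then r else 0) \<le> r" using r_nonneg by auto
    ultimately have "- H \<le> snd (lower i)" "snd (lower i) \<le> H"
      using H_large unfolding lower_def snd_conv by linarith+
    then show ?thesis using b by (simp add: lower_def abs_le_iff)
  qed
  then have "lower i \<in> {-k..k} \<times> {-H..H}" "- lower i \<in> {-k..k} \<times> {-H..H}" if "i \<le> K" for i
    using that by (simp_all add: mem_Times_iff minus_le_iff)
  then show ?thesis unfolding verts_eq by blast
qed

lemma centrally_symmetric_hull: "centrally_symmetric (poly_hull verts)"
proof -
  have "uminus ` verts = verts" unfolding verts_eq image_Un image_image by auto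
  then have "(\<lambda>x. - x) ` emb ` verts = emb ` verts"
    unfolding image_image emb_uminus[symmetric] by (metis image_image)
  then have "(\<lambda>x. - x) ` poly_hull verts = poly_hull verts"
    unfolding poly_hull_def by (metis convex_hull_linear_image linear_uminus)
  then show ?thesis
    unfolding centrally_symmetric_def
    by (intro bexI[of _ 0]) (auto simp: int_lattice_def)
qed

lemma hull_in_cs_polytopes:
  assumes "measure lebesgue (poly_hull verts) = real m / 2" "0 < m"
  shows "poly_hull verts \<in> cs_polytopes m"
proof -
  have "interior (poly_hull verts) \<noteq> {}"
  proof
    assume "interior (poly_hull verts) = {}"
    then have "negligible (poly_hull verts)"
      by (simp add: negligible_convex_interior poly_hull_def)
    then show False using assms negligible_imp_measure0 by fastforce
  qed
  then show ?thesis
    using assms centrally_symmetric_hull finite_verts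
    by (auto simp: cs_polytopes_def full_dim_lattice_polytope_def lattice_polytope_eq)
qed

end

subsection \<open>Exponentially many polygons of the same area\<close>

text \<open>The vertices at -3n and 1 - 3n serve the area adjustment: the polygon's edge above the
  first vertex is vertical, so raising it by r cuts off a triangle with base r and width 1, and with
  the mirror image exactly r is lost. From index 2 on, even indices are the block ends 3l and odd
  ones the inner points, where \<open>B\<close> makes the choice.\<close>

definition xcoord :: "nat \<Rightarrow> nat set \<Rightarrow> nat \<Rightarrow> int" where
  "xcoord n B t = (if t = 0 then - 3 * int n else if t = 1 then 1 - 3 * int n
     else 3 * int ((t - 2) div 2) + (if even t then 0 else if (t - 2) div 2 \<in> B then 1 else 2))"

lemma xcoord_0: "xcoord n B 0 = - 3 * int n" "xcoord n B (Suc 0) = 1 - 3 * int n"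
  by (simp_all add: xcoord_def)

lemma xcoord_even: "xcoord n B (2 * l + 2) = 3 * int l"
  by (simp add: xcoord_def)

lemma xcoord_odd: "xcoord n B (2 * l + 3) = 3 * int l + (if l \<in> B then 1 else 2)"
proof -
  have "(2 * l + 3 - 2) div 2 = l" by simp
  then show ?thesis unfolding xcoord_def by simp
qed

lemma xcoord_Suc:
  assumes "1 \<le> n" shows "xcoord n B t < xcoord n B (Suc t)"
proof -
  consider "t = 0" | "t = 1" | l where "t = 2 * l + 2" | l where "t = 2 * l + 3"
  proof (cases "t < 2")
    case False
    then obtain s where s: "t = s + 2" by (metis add.commute le_Suc_ex not_less)
    show ?thesis
    proof (cases "even s")
      case True then show ?thesis using that(3)[of "s div 2"] s by simp
    next
      case False then show ?thesis using that(4)[of "s div 2"] s by (auto elim!: oddE)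
    qed
  qed (use that in linarith)
  then show ?thesis
  proof cases
    case 2
    then show ?thesis using xcoord_even[of n B 0] assms by (simp add: xcoord_0 numeral_2_eq_2)
  next
    case 3
    then show ?thesis using xcoord_even[of n B l] xcoord_odd[of n B l] by (simp add: eval_nat_numeral)
  next
    case 4
    then show ?thesis using xcoord_even[of n B "Suc l"] xcoord_odd[of n B l] by (simp add: eval_nat_numeral)
  qed (simp add: xcoord_0)
qed

lemma xcoord_mono: "1 \<le> n \<Longrightarrow> i < j \<Longrightarrow> xcoord n B i < xcoord n B j"
  using lift_Suc_mono_less[of "xcoord n B"] xcoord_Suc by blast

lemma xcoord_bound:
  assumes "1 \<le> n" "i \<le> 2 * n + 2" shows "\<bar>xcoord n B i\<bar> \<le> 3 * int n"
proof -
  have "xcoord n B 0 \<le> xcoord n B i"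
    using xcoord_mono[OF assms(1), of 0 i B] by (cases "i = 0") auto
  moreover have "xcoord n B i \<le> xcoord n B (2 * n + 2)"
    using xcoord_mono[OF assms(1), of i "2 * n + 2" B] assms(2) by (cases "i = 2 * n + 2") auto
  ultimately show ?thesis unfolding xcoord_even xcoord_0 by simp
qed

locale parabola_family =
  fixes n :: nat and H r :: int
  assumes n_pos: "1 \<le> n" and r_ge: "0 \<le> r"
    and H_gt: "3 * (3 * int n)\<^sup>2 + r + 3 * int n * r < H"
begin

sublocale chain: parabola_chain "xcoord n B" "2 * n + 2" "3 * int n" H r for B
  by unfold_locales (use n_pos r_ge H_gt xcoord_mono xcoord_bound in auto)

abbreviation polygon :: "nat set \<Rightarrow> (real ^ 2) set" where
  "polygon B \<equiv> poly_hull (chain.verts B)"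

text \<open>Independent of \<open>B\<close>: over the chord of a block either inner point spans a
  triangle of doubled area 1 * 2 * 3.\<close>

lemma sum_cross_blocks:
  "(\<Sum>t<2 * q. cross2 (emb (chain.lower B (t + 2))) (emb (chain.lower B (t + 3)))) =
     of_int (3 * int q * H + 9 * int q ^ 3 - 3 * int q)"
proof (induction q)
  case (Suc q)
  have e: "2 * Suc q + 2 = 2 * q + 4" by simp
  have x4: "xcoord n B (2 * q + 4) = 3 * int q + 3"
    using xcoord_even[of n B "Suc q", unfolded e] by simp
  have l: "chain.lower B (2 * q + 2) = (3 * int q, (3 * int q)\<^sup>2 - H)"
    "chain.lower B (2 * q + 3) = (3 * int q + (if q \<in> B then 1 else 2), (3 * int q + (if q \<in> B then 1 else 2))\<^sup>2 - H)"
    "chain.lower B (2 * q + 4) = (3 * int q + 3, (3 * int q + 3)\<^sup>2 - H)"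
    unfolding chain.lower_def x4 xcoord_even xcoord_odd by simp_all
  have "(\<Sum>t<2 * Suc q. cross2 (emb (chain.lower B (t + 2))) (emb (chain.lower B (t + 3)))) =
     of_int (3 * int q * H + 9 * int q ^ 3 - 3 * int q)
      + cross2 (emb (chain.lower B (2 * q + 2))) (emb (chain.lower B (2 * q + 3)))
      + cross2 (emb (chain.lower B (2 * q + 3))) (emb (chain.lower B (2 * q + 4)))"
    using Suc by (simp add: eval_nat_numeral)
  also have "\<dots> = of_int (3 * int (Suc q) * H + 9 * int (Suc q) ^ 3 - 3 * int (Suc q))"
    unfolding l cross2_emb by (cases "q \<in> B") (simp_all add: algebra_simps power2_eq_square power3_eq_cube)
  finally show ?case .
qed simp

lemma area: "measure lebesgue (polygon B) =
   of_int (12 * int n * H - r - 45 * int n ^ 3 + 9 * int n ^ 2 - 6 * int n)"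
proof -
  let ?c = "\<lambda>i. cross2 (emb (chain.lower B i)) (emb (chain.lower B (Suc i)))"
  have l: "chain.lower B 0 = (- 3 * int n, (- 3 * int n)\<^sup>2 - H + r)"
    "chain.lower B 1 = (1 - 3 * int n, (1 - 3 * int n)\<^sup>2 - H)"
    "chain.lower B 2 = (0, - H)"
    "chain.lower B (2 * n + 2) = (3 * int n, (3 * int n)\<^sup>2 - H)"
    using xcoord_even[of n B 0] xcoord_even[of n B n]
    by (simp_all add: chain.lower_def xcoord_0 eval_nat_numeral)
  have "(\<Sum>i<2 * n + 2. ?c i) = (\<Sum>i<2. ?c i) + (\<Sum>i<2 * n. ?c (2 + i))"
    using sum_lessThan_add[of ?c 2 "2 * n"] by (simp add: add.commute)
  also have "(\<Sum>i<2 * n. ?c (2 + i)) = of_int (3 * int n * H + 9 * int n ^ 3 - 3 * int n)"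
    using sum_cross_blocks[of B n] by (simp add: eval_nat_numeral)
  also have "(\<Sum>i<2. ?c i) = cross2 (emb (chain.lower B 0)) (emb (chain.lower B 1))
      + cross2 (emb (chain.lower B 1)) (emb (chain.lower B 2))"
    by (simp add: eval_nat_numeral)
  finally have "measure lebesgue (polygon B) = cross2 (emb (chain.lower B 0)) (emb (chain.lower B 1))
      + cross2 (emb (chain.lower B 1)) (emb (chain.lower B 2))
      + of_int (3 * int n * H + 9 * int n ^ 3 - 3 * int n)
      + cross2 (emb (chain.lower B 0)) (emb (chain.lower B (2 * n + 2)))"
    unfolding chain.measure_verts by simp
  then show ?thesis
    unfolding l cross2_emb by (simp add: algebra_simps power2_eq_square power3_eq_cube)
qed

text \<open>For l in \<open>B\<close> but not in \<open>B'\<close>, the vertex of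
  \<open>polygon B\<close> at 3l + 1 lies strictly below the edge of \<open>polygon B'\<close> from
  3l to 3l + 2.\<close>

lemma polygon_subset:
  assumes "polygon B = polygon B'" "B \<subseteq> {..<n}" shows "B \<subseteq> B'"
proof (rule ccontr)
  assume "\<not> B \<subseteq> B'"
  then obtain l where l: "l \<in> B" "l \<notin> B'" by blast
  have "l < n" using l assms(2) by auto
  have "emb (chain.lower B (2 * l + 3)) \<in> polygon B'"
    using chain.lower_in_hull[of "2 * l + 3" B] \<open>l < n\<close> assms(1) by simp
  then have "0 \<le> orient (emb (chain.vert B' (2 * l + 2))) (emb (chain.vert B' (Suc (2 * l + 2)))) (emb (chain.lower B (2 * l + 3)))"
    using \<open>l < n\<close> by (intro chain.edge_nonneg) auto
  moreover have "chain.vert B' (2 * l + 2) = chain.lower B' (2 * l + 2)"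
    by (rule chain.vert_lower) (use \<open>l < n\<close> in simp)
  moreover have "chain.vert B' (Suc (2 * l + 2)) = chain.lower B' (2 * l + 3)"
    using chain.vert_lower[of "Suc (2 * l + 2)" B'] \<open>l < n\<close> by (simp add: eval_nat_numeral)
  moreover have "chain.lower B' (2 * l + 2) = (3 * int l, (3 * int l)\<^sup>2 - H)"
    "chain.lower B' (2 * l + 3) = (3 * int l + 2, (3 * int l + 2)\<^sup>2 - H)"
    "chain.lower B (2 * l + 3) = (3 * int l + 1, (3 * int l + 1)\<^sup>2 - H)"
    unfolding chain.lower_def xcoord_even xcoord_odd using l by simp_all
  ultimately have "0 \<le> orient (emb (3 * int l, (3 * int l)\<^sup>2 - H)) (emb (3 * int l + 2, (3 * int l + 2)\<^sup>2 - H))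
     (emb (3 * int l + 1, (3 * int l + 1)\<^sup>2 - H))" by simp
  then show False unfolding orient_emb by (simp add: algebra_simps power2_eq_square)
qed

text \<open>A lattice equivalence is determined by the images of three vertices, and these are lattice
  points of the box around the polygon.\<close>

lemma card_equivalent_le:
  assumes "B0 \<subseteq> {..<n}"
  shows "card {B. B \<subseteq> {..<n} \<and> lattice_equivalent (polygon B0) (polygon B)}
     \<le> nat ((6 * int n + 1) * (2 * H + 1)) ^ 3"
proof -
  let ?A = "{B. B \<subseteq> {..<n} \<and> lattice_equivalent (polygon B0) (polygon B)}"
  define box where "box = {- (3 * int n)..3 * int n} \<times> {- H..H}"
  have hull_box: "p \<in> box" if "emb p \<in> polygon B" for p B
  proof -
    have "polygon B \<subseteq> cbox (emb (- (3 * int n), - H)) (emb (3 * int n, H))"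
      unfolding poly_hull_def
    proof (rule hull_minimal)
      show "emb ` chain.verts B \<subseteq> cbox (emb (- (3 * int n), - H)) (emb (3 * int n, H))"
      proof
        fix x assume "x \<in> emb ` chain.verts B"
        then obtain z where z: "x = emb z" "z \<in> {- (3 * int n)..3 * int n} \<times> {- H..H}"
          using chain.verts_box[of B] by blast
        have "- (3 * int n) \<le> fst z" "fst z \<le> 3 * int n" "- H \<le> snd z" "snd z \<le> H"
          using z(2) by (auto simp: mem_Times_iff)
        then have "real_of_int (- (3 * int n)) \<le> fst z" "fst z \<le> real_of_int (3 * int n)"
          "real_of_int (- H) \<le> snd z" "snd z \<le> real_of_int H" by (simp_all only: of_int_le_iff)
        then show "x \<in> cbox (emb (- (3 * int n), - H)) (emb (3 * int n, H))"
          by (simp only: z(1) mem_box_cart forall_2 emb_nth fst_conv snd_conv)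
      qed
    qed (rule convex_box)
    then have "emb p \<in> cbox (emb (- (3 * int n), - H)) (emb (3 * int n, H))" using that by blast
    then have "real_of_int (- (3 * int n)) \<le> fst p" "fst p \<le> real_of_int (3 * int n)"
          "real_of_int (- H) \<le> snd p" "snd p \<le> real_of_int H"
      by (simp_all only: mem_box_cart forall_2 emb_nth fst_conv snd_conv)
    then show ?thesis unfolding box_def mem_Times_iff by (simp only: of_int_le_iff) simp
  qed
  have "\<exists>\<sigma>. affine_transformation \<sigma> \<and> \<sigma> ` int_lattice = int_lattice \<and> \<sigma> ` polygon B0 = polygon B" if "B \<in> ?A" for B
    using that by (simp add: lattice_equivalent_def)
  then have "\<forall>B\<in>?A. \<exists>\<sigma>. affine_transformation \<sigma> \<and> \<sigma> ` int_lattice = int_lattice \<and> \<sigma> ` polygon B0 = polygon B" ..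
  from bchoice[OF this] obtain \<sigma> where "\<forall>B\<in>?A. affine_transformation (\<sigma> B) \<and>
      \<sigma> B ` int_lattice = int_lattice \<and> \<sigma> B ` polygon B0 = polygon B" ..
  then have \<sigma>: "\<And>B. B \<in> ?A \<Longrightarrow> affine_transformation (\<sigma> B) \<and>
      \<sigma> B ` int_lattice = int_lattice \<and> \<sigma> B ` polygon B0 = polygon B" by (rule bspec)
  let ?z = "\<lambda>i. emb (chain.lower B0 i)"
  define F where "F B = (\<sigma> B (?z 0), \<sigma> B (?z 1), \<sigma> B (?z 2))" for B
  have im: "\<sigma> B (?z i) \<in> emb ` box" if "B \<in> ?A" "i \<le> 2" for B i
  proof -
    have "?z i \<in> polygon B0" using that n_pos by (intro chain.lower_in_hull) auto
    then have "\<sigma> B (?z i) \<in> polygon B" using \<sigma>[OF that(1)] by blast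
    moreover have "\<sigma> B (?z i) \<in> range emb" using \<sigma>[OF that(1)] unfolding int_lattice_eq by blast
    ultimately obtain p where "\<sigma> B (?z i) = emb p" "emb p \<in> polygon B" by auto
    then show ?thesis using hull_box by simp
  qed
  have inj: "inj_on F ?A"
  proof (rule inj_onI)
    fix B C assume BC: "B \<in> ?A" "C \<in> ?A" "F B = F C"
    obtain f b where f: "linear f" "\<sigma> B = (\<lambda>x. f x + b)"
      using \<sigma>[OF BC(1), THEN conjunct1] unfolding affine_transformation_def by (elim exE conjE)
    obtain g c where g: "linear g" "\<sigma> C = (\<lambda>x. g x + c)"
      using \<sigma>[OF BC(2), THEN conjunct1] unfolding affine_transformation_def by (elim exE conjE)
    have pos: "orient (?z 0) (?z 1) (?z 2) \<noteq> 0"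
      using chain.orient_lower[of 0 1 2 B0] n_pos by simp
    have e: "f (?z 0) + b = g (?z 0) + c" "f (?z 1) + b = g (?z 1) + c" "f (?z 2) + b = g (?z 2) + c"
      using BC(3) by (simp_all add: F_def f(2) g(2))
    have "\<sigma> B x = \<sigma> C x" for x
    proof -
      define u v w where "u = orient (?z 0) x (?z 2) / orient (?z 0) (?z 1) (?z 2)"
        and "v = orient x (?z 1) (?z 2) / orient (?z 0) (?z 1) (?z 2)"
        and "w = orient (?z 0) (?z 1) x / orient (?z 0) (?z 1) (?z 2)"
      have x: "x = u *\<^sub>R ?z 1 + v *\<^sub>R ?z 0 + w *\<^sub>R ?z 2"
        unfolding u_def v_def w_def by (rule barycentric_orient[OF pos])
      have s: "u + v + w = 1"
        using orient_sum[of "?z 0" x "?z 2" "?z 1"] pos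
        unfolding u_def v_def w_def by (simp flip: add_divide_distrib)
      have *: "h x + d = u *\<^sub>R (h (?z 1) + d) + v *\<^sub>R (h (?z 0) + d) + w *\<^sub>R (h (?z 2) + d)"
        if "linear h" for h :: "real ^ 2 \<Rightarrow> real ^ 2" and d
      proof -
        have "h x = u *\<^sub>R h (?z 1) + v *\<^sub>R h (?z 0) + w *\<^sub>R h (?z 2)"
          by (subst x) (simp only: linear_add[OF that] linear_scale[OF that])
        then have "h x + d = u *\<^sub>R h (?z 1) + v *\<^sub>R h (?z 0) + w *\<^sub>R h (?z 2) + (u + v + w) *\<^sub>R d"
          using s by simp
        then show ?thesis by (simp only: scaleR_add_right scaleR_add_left ac_simps)
      qed
      have "f x + b = g x + c" using *[OF f(1), of b] *[OF g(1), of c] unfolding e by (rule trans[OF _ sym])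
      then show ?thesis by (simp only: f(2) g(2))
    qed
    then have "\<sigma> B = \<sigma> C" ..
    then have "polygon B = polygon C"
      using \<sigma>[OF BC(1), THEN conjunct2, THEN conjunct2] \<sigma>[OF BC(2), THEN conjunct2, THEN conjunct2] by simp
    moreover have "B \<subseteq> {..<n}" "C \<subseteq> {..<n}" using BC(1,2) by simp_all
    ultimately have "B \<subseteq> C" "C \<subseteq> B" by (simp_all only: polygon_subset)
    then show "B = C" ..
  qed
  have sub: "F ` ?A \<subseteq> emb ` box \<times> emb ` box \<times> emb ` box"
  proof (rule image_subsetI)
    fix B assume "B \<in> ?A"
    from im[OF this, of 0] im[OF this, of 1] im[OF this, of 2]
    show "F B \<in> emb ` box \<times> emb ` box \<times> emb ` box" by (simp add: F_def)
  qed
  have "finite (emb ` box \<times> emb ` box \<times> emb ` box)" by (simp add: box_def)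
  then have "card ?A \<le> card (emb ` box \<times> emb ` box \<times> emb ` box)"
    by (rule card_inj_on_le[OF inj sub])
  also have "\<dots> = card box ^ 3"
    by (simp add: card_cartesian_product card_image inj_on_subset[OF inj_emb] power3_eq_cube)
  also have "card box = nat ((6 * int n + 1) * (2 * H + 1))"
  proof -
    have "card box = nat (6 * int n + 1) * nat (2 * H + 1)"
      by (simp add: box_def card_cartesian_product algebra_simps)
    also have "\<dots> = nat ((6 * int n + 1) * (2 * H + 1))" by (rule nat_mult_distrib[symmetric]) simp
    finally show ?thesis .
  qed
  finally show ?thesis .
qed

text \<open>Pigeonhole: the 2^n choices are distributed over the classes, and no class receives more
  than the number of choices equivalent to a fixed one.\<close>

lemma card_classes_ge:
  assumes m: "real m = 2 * of_int (12 * int n * H - r - 45 * int n ^ 3 + 9 * int n ^ 2 - 6 * int n)" "0 < m"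
  shows "2 ^ n \<le> v_star TYPE(2) m * nat ((6 * int n + 1) * (2 * H + 1)) ^ 3"
proof -
  let ?Q = "(cs_polytopes m :: (real ^ 2) set set) // cs_equiv_rel m"
  let ?R = "nat ((6 * int n + 1) * (2 * H + 1)) ^ 3"
  have cs: "polygon B \<in> cs_polytopes m" for B
    by (rule chain.hull_in_cs_polytopes) (use area[of B] m in auto)
  define c where "c B = cs_equiv_rel m `` {polygon B}" for B
  have c: "c B \<in> ?Q" for B unfolding c_def using cs by (rule quotientI)
  have finQ: "finite ?Q" using classes_bound(1)[OF m(2)] .
  have "Pow {..<n} = (\<Union>X\<in>?Q. {B. B \<subseteq> {..<n} \<and> c B = X})" using c by auto
  then have "2 ^ n = card (\<Union>X\<in>?Q. {B. B \<subseteq> {..<n} \<and> c B = X})" by (metis card_Pow card_lessThan finite_lessThan)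
  also have "\<dots> \<le> (\<Sum>X\<in>?Q. card {B. B \<subseteq> {..<n} \<and> c B = X})" by (rule card_UN_le[OF finQ])
  also have "\<dots> \<le> (\<Sum>X\<in>?Q. ?R)"
  proof (rule sum_mono)
    fix X
    show "card {B. B \<subseteq> {..<n} \<and> c B = X} \<le> ?R"
    proof (cases "\<exists>B0\<subseteq>{..<n}. c B0 = X")
      case True
      then obtain B0 where B0: "B0 \<subseteq> {..<n}" "c B0 = X" by blast
      have "lattice_equivalent (polygon B0) (polygon B)" if "c B = X" for B
      proof -
        have "cs_equiv_rel m `` {polygon B0} = cs_equiv_rel m `` {polygon B}"
          using that B0(2) by (simp only: c_def)
        then have "(polygon B0, polygon B) \<in> cs_equiv_rel m"
          by (rule eq_equiv_class[OF _ equiv_cs_equiv_rel cs])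
        then show ?thesis by (simp add: cs_equiv_rel_def)
      qed
      then have sub: "{B. B \<subseteq> {..<n} \<and> c B = X} \<subseteq> {B. B \<subseteq> {..<n} \<and> lattice_equivalent (polygon B0) (polygon B)}"
        by blast
      have "finite {B. B \<subseteq> {..<n} \<and> lattice_equivalent (polygon B0) (polygon B)}"
        by (rule finite_subset[of _ "Pow {..<n}"]) auto
      from card_mono[OF this sub] card_equivalent_le[OF B0(1)] show ?thesis by (rule order_trans)
    next
      case False
      then have "{B. B \<subseteq> {..<n} \<and> c B = X} = {}" by blast
      then show ?thesis by (simp only: card.empty)
    qed
  qed
  also have "\<dots> = v_star TYPE(2) m * ?R" by (simp add: v_star_def)
  finally show ?thesis .
qed

end



subsection \<open>The lower bound\<close>

lemma two_power_le_v_star: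
  assumes "1 \<le> n" "900 * n ^ 3 < N"
  shows "2 ^ n \<le> v_star TYPE(2) (2 * N) * (3 * N ^ 2) ^ 3"
proof -
  define a where "a = int n"
  have a: "1 \<le> a" using assms by (simp add: a_def)
  have "a * 1 \<le> a * a" using a by (intro mult_left_mono) auto
  moreover have "a\<^sup>2 * 1 \<le> a\<^sup>2 * a" using a by (intro mult_left_mono) auto
  ultimately have pw: "a \<le> a\<^sup>2" "a\<^sup>2 \<le> a ^ 3" by (simp_all only: power2_eq_square power3_eq_cube mult_1_right)
  have "int (900 * n ^ 3) < int N" using assms(2) by (simp only: of_nat_less_iff)
  then have N: "900 * a ^ 3 < int N" by (simp add: a_def)
  \<comment> \<open>The area equation reads 12aH - r = A. So \<open>H\<close> is A / (12a) rounded
    up, and \<open>r\<close> is the excess, smaller than 12a.\<close>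
  define A where "A = int N + 45 * a ^ 3 - 9 * a\<^sup>2 + 6 * a"
  define H r where "H = (A + 12 * a - 1) div (12 * a)" and "r = 12 * a * H - A"
  have "12 * a * H = A + 12 * a - 1 - (A + 12 * a - 1) mod (12 * a)"
    unfolding H_def by (simp add: minus_mod_eq_mult_div)
  moreover have "0 \<le> (A + 12 * a - 1) mod (12 * a)" "(A + 12 * a - 1) mod (12 * a) < 12 * a"
    using a by simp_all
  ultimately have r: "0 \<le> r" "r \<le> 12 * a - 1" unfolding r_def by linarith+
  have AN: "int N \<le> A" using pw a unfolding A_def by linarith
  \<comment> \<open>The family needs H > 27a^2 + (1 + 3a) r, and (1 + 3a) r \<le> 48a^2. The sum
    75a^2 is the origin of the constant 900 = 12 * 75.\<close>
  have "12 * a * (75 * a\<^sup>2) < 12 * a * H"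
  proof -
    have "12 * a * (75 * a\<^sup>2) = 900 * a ^ 3" by (simp add: power2_eq_square power3_eq_cube)
    then show ?thesis using r(1) AN N unfolding r_def by linarith
  qed
  then have H: "75 * a\<^sup>2 < H" using a by (simp only: mult_less_cancel_left)
  have "(1 + 3 * a) * r \<le> (4 * a) * (12 * a)" by (rule mult_mono) (use r a in auto)
  then have "3 * (3 * a)\<^sup>2 + r + 3 * a * r < H"
    using H by (simp add: power2_eq_square algebra_simps)
  then interpret parabola_family n H r
    by unfold_locales (use assms(1) r(1) in \<open>simp_all add: a_def\<close>)
  have N0: "0 < N" using assms(2) by simp
  have "12 * a * H - r - 45 * a ^ 3 + 9 * a ^ 2 - 6 * a = int N"
    by (simp add: r_def A_def)
  then have "2 ^ n \<le> v_star TYPE(2) (2 * N) * nat ((6 * a + 1) * (2 * H + 1)) ^ 3"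
    using card_classes_ge[of "2 * N"] N0 unfolding a_def by simp
  also have "nat ((6 * a + 1) * (2 * H + 1)) \<le> 3 * N ^ 2"
  proof -
    have H0: "0 \<le> H" using H by (smt (verit) zero_le_power2)
    have "12 * H \<le> 12 * a * H" using a H0 by (intro mult_right_mono) auto
    then have "12 * H \<le> A + 12 * a" using r(2) unfolding r_def by linarith
    then have "2 * H + 1 \<le> 3 * int N" using N pw a unfolding A_def by linarith
    moreover have "6 * a + 1 \<le> int N" using N pw a by linarith
    ultimately have "(6 * a + 1) * (2 * H + 1) \<le> int N * (3 * int N)"
      using H0 by (intro mult_mono) auto
    then show ?thesis by (simp add: nat_le_iff power2_eq_square algebra_simps)
  qed
  finally show ?thesis by (simp add: power_mono)
qed

lemma ln_v_star_lower:
  "eventually (\<lambda>m. even m \<longrightarrow> 1 / 100 * real m powr (1/3) \<le> ln (real (v_star TYPE(2) m))) sequentially"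
proof -
  \<comment> \<open>The leading coefficients are 1/100 on the left and 1/40 on the right; the
    difference absorbs the logarithms of the polynomial factor.\<close>
  have "eventually (\<lambda>x::real. x powr (1/3) / 100 + ln 27 + 6 * ln x \<le> (x powr (1/3) / 20 - 1) / 2) at_top"
    by real_asymp
  then have "eventually (\<lambda>m. real m powr (1/3) / 100 + ln 27 + 6 * ln (real m) \<le> (real m powr (1/3) / 20 - 1) / 2) sequentially"
    using filterlim_real_sequentially by (rule eventually_compose_filterlim)
  moreover have "eventually (\<lambda>m::nat. 2000 \<le> m) sequentially" by (rule eventually_ge_at_top)
  ultimately show ?thesis
  proof eventually_elim
    case (elim m)
    show ?case
    proof
      assume "even m"
      then obtain N where N: "m = 2 * N" by (rule evenE)
      \<comment> \<open>Dividing by the cube 1000 > 900 gives 900 n^3 < N for n the integer part of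
        s; m \<ge> 2000 ensures s \<ge> 1 and hence n \<ge> 1.\<close>
      define s where "s = (real N / 1000) powr (1/3)"
      have s3: "s ^ 3 = real N / 1000" using elim(2) N unfolding s_def by (simp add: powr_power)
      have s1: "1 \<le> s" unfolding s_def using elim(2) N by (intro ge_one_powr_ge_zero) auto
      define n where "n = nat \<lfloor>s\<rfloor>"
      have n: "real n \<le> s" "s - 1 \<le> real n" "1 \<le> n" using s1 unfolding n_def by linarith+
      have "real n ^ 3 \<le> s ^ 3" using n by (intro power_mono) auto
      then have "real (900 * n ^ 3) < real N" using s3 elim(2) N by simp
      then have "900 * n ^ 3 < N" by (simp only: of_nat_less_iff)
      note pow = two_power_le_v_star[OF n(3) this, folded N]
      then have le: "real (2 ^ n) \<le> real (v_star TYPE(2) m * (3 * N ^ 2) ^ 3)"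
        by (simp only: of_nat_le_iff)
      have v: "0 < v_star TYPE(2) m" using pow by (cases "v_star TYPE(2) m = 0") simp_all
      have N0: "0 < real N" using elim(2) N by simp
      have "real n * ln 2 = ln (real (2 ^ n))" by (simp add: ln_realpow)
      also have "\<dots> \<le> ln (real (v_star TYPE(2) m * (3 * N ^ 2) ^ 3))" using le by (intro ln_mono) auto
      also have "\<dots> = ln (real (v_star TYPE(2) m) * (27 * real N ^ 6))" by (simp add: power_mult_distrib flip: power_mult)
      also have "\<dots> = ln (real (v_star TYPE(2) m)) + ln 27 + 6 * ln (real N)"
        using v N0 by (simp add: ln_mult ln_realpow)
      also have "\<dots> \<le> ln (real (v_star TYPE(2) m)) + ln 27 + 6 * ln (real m)" using N N0 by simp
      finally have 1: "real n * ln 2 \<le> ln (real (v_star TYPE(2) m)) + ln 27 + 6 * ln (real m)" .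
      \<comment> \<open>s^3 is m / 2000; weakening it to m / 8000 makes the cube root rational, as
        8000 = 20^3.\<close>
      have "(real m / 8000) powr (1/3) \<le> s" unfolding s_def N by (intro powr_mono2) auto
      moreover have "(real m / 8000) powr (1/3) = real m powr (1/3) / 20"
      proof -
        have "(8000::real) powr (1/3) = (20 powr 3) powr (1/3)" by simp
        also have "\<dots> = 20" by (simp only: powr_powr) simp
        finally show ?thesis by (simp add: powr_divide)
      qed
      ultimately have "real m powr (1/3) / 20 - 1 \<le> real n" using n by simp
      then have "(real m powr (1/3) / 20 - 1) / 2 \<le> real n / 2" by simp
      also have "\<dots> \<le> real n * ln 2"
        using mult_left_mono[of "1/2" "ln 2" "real n"] ln2_ge_two_thirds by simp
      finally show "1 / 100 * real m powr (1/3) \<le> ln (real (v_star TYPE(2) m))"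
        using 1 elim(1) by linarith
    qed
  qed
qed

theorem theorem1:
  shows "\<exists>c1 c2 :: real. c1 > 0 \<and> c2 > 0 \<and> (\<exists>m0 :: nat. m0 > 0 \<and>
    (\<forall>m \<ge> m0. even m \<longrightarrow>
       c1 * real m powr (1/3) \<le> ln (real (v_star TYPE(2) m)) \<and>
       ln (real (v_star TYPE(2) m)) \<le> c2 * real m powr (1/3)))"
proof -
  obtain M where M: "\<And>m. M \<le> m \<Longrightarrow> even m \<Longrightarrow>
      1 / 100 * real m powr (1/3) \<le> ln (real (v_star TYPE(2) m))"
    using ln_v_star_lower unfolding eventually_sequentially by blast
  show ?thesis
  proof (intro exI conjI allI impI)
    \<comment> \<open>The threshold \<open>Suc M\<close> is positive, which also keeps m = 0 out of
      the upper bound.\<close>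
    show "(0::real) < 1 / 100" "(0::real) < 130" "0 < Suc M" by simp_all
  next
    fix m assume m: "Suc M \<le> m" "even m"
    show "1 / 100 * real m powr (1/3) \<le> ln (real (v_star TYPE(2) m))" using M m by simp
    show "ln (real (v_star TYPE(2) m)) \<le> 130 * real m powr (1/3)" using ln_v_star_upper m by simp
  qed
qed

end
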